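(* Let $N$ be a nondegenerate random variable with values in the positive integers satisfying $\mathbb{E}[N\log N]<\infty$, and let $$\mu:=\min\{n\in\mathbb{N}\colon \mathbb{P}(N=n)>0\}\ge 1 .$$ Let $T$ be a Galton--Watson tree with offspring variable $N$, let $Z_k$ denote the size of its $k$th generation (so $Z_0=1$), let $a:=\mathbb{E}N$, and let $W:=\lim_{n\to\infty} Z_n/a^n$ be the associated martingale limit. Then, as $\varepsilon\downarrow 0$, conditionally on the event $\{W<\varepsilon\}$ the tree $T$ converges in law on $(\mathcal{T},d)$ to the regular $\mu$-ary tree (the deterministic rooted tree in which every vertex has exactly $\mu$ children). Equivalently, for all $k\in\mathbb{N}$, $$\lim_{\varepsilon\downarrow 0}\mathbb{P}\big(Z_k=\mu^k \,\big|\, W<\varepsilon\big)=1 .$$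
   Context: A Galton--Watson tree with offspring variable $N$ is the random rooted tree started from a single root in which every vertex independently has a number of children distributed as $N$. Since $\mathbb{P}(N=0)=0$ and $\mathbb{E}[N\log N]<\infty$, the limit $W=\lim_{n\to\infty} Z_n/a^n$ exists and is strictly positive almost surely (Kesten--Stigum theorem). "Nondegenerate" means that $N$ is not almost surely constant. $\mathcal{T}$ denotes the space of all rooted trees in which every vertex has finite degree. The metric $d$ on $\mathcal{T}$ is determined by $d(T_1,T_2)=e^{-n}$, where $n$ is maximal with the property that the trees $T_1$ and $T_2$ coincide up to the $n$th generation (and $d(T_1,T_2)=0$ if $T_1=T_2$). With this metric $(\mathcal{T},d)$ is a complete, separable metric space, and convergence in law is with respect to this metric. *)

theory Defs
  imports "HOL-Probability.Probability"
begin

text \<open>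
  Locally finite rooted trees in Ulam--Harris coding: a vertex is the word of child labels on the
  path leading to it from the root \<open>[]\<close>, and the children of a vertex \<open>u\<close> with \<open>k\<close> children are
  \<open>u @ [0], \<dots>, u @ [k - 1]\<close>.
\<close>

typedef rooted_tree =
  "{t :: nat list set. [] \<in> t \<and> (\<forall>u j. u @ [j] \<in> t \<longrightarrow> u \<in> t) \<and>
      (\<forall>u i j. u @ [j] \<in> t \<longrightarrow> i < j \<longrightarrow> u @ [i] \<in> t) \<and>
      (\<forall>u. finite {j. u @ [j] \<in> t})}"
  morphisms vertices Abs_rooted_tree
  by (rule exI[of _ "{[]}"]) simp

definition trunc :: "nat \<Rightarrow> rooted_tree \<Rightarrow> nat list set" where
  "trunc n t = {u \<in> vertices t. length u \<le> n}"

definition generation_size :: "rooted_tree \<Rightarrow> nat \<Rightarrow> nat" where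
  "generation_size t k = card {u \<in> vertices t. length u = k}"

lemma trunc_0 [simp]: "trunc 0 t = {[]}"
  using vertices[of t] by (auto simp: trunc_def)

lemma trunc_mono: "trunc n s = trunc n t \<Longrightarrow> m \<le> n \<Longrightarrow> trunc m s = trunc m t"
proof -
  assume "trunc n s = trunc n t" "m \<le> n"
  moreover have "trunc m r = {u \<in> trunc n r. length u \<le> m}" if "m \<le> n" for r
    using that by (auto simp: trunc_def)
  ultimately show ?thesis by simp
qed

lemma trunc_eqI:
  assumes "\<And>n. trunc n s = trunc n t"
  shows "s = t"
proof -
  have "u \<in> vertices r \<longleftrightarrow> u \<in> trunc (length u) r" for u r
    by (simp add: trunc_def)
  then have "vertices s = vertices t"
    using assms by blast
  then show ?thesis
    by (simp add: vertices_inject)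
qed

lemma finite_trunc: "finite (trunc n t)"
proof (induction n)
  case (Suc n)
  have "trunc (Suc n) t \<subseteq> insert [] (\<Union>u\<in>trunc n t. (\<lambda>j. u @ [j]) ` {j. u @ [j] \<in> vertices t})"
  proof
    fix u assume u: "u \<in> trunc (Suc n) t"
    show "u \<in> insert [] (\<Union>u\<in>trunc n t. (\<lambda>j. u @ [j]) ` {j. u @ [j] \<in> vertices t})"
    proof (cases u rule: rev_cases)
      case (snoc v j)
      then have "v \<in> trunc n t" "u \<in> vertices t"
        using u vertices[of t] by (simp_all add: trunc_def) blast
      then show ?thesis using snoc by blast
    qed simp
  qed
  moreover have "finite {j. u @ [j] \<in> vertices t}" for u
    using vertices[of t] by simp
  ultimately show ?case
    using Suc by (meson finite.insertI finite_UN_I finite_imageI finite_subset)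
qed simp

instantiation rooted_tree :: metric_space
begin

definition dist_rooted_tree :: "rooted_tree \<Rightarrow> rooted_tree \<Rightarrow> real" where
  "dist s t = (if s = t then 0 else exp (- real (GREATEST n. trunc n s = trunc n t)))"

definition uniformity_rooted_tree :: "(rooted_tree \<times> rooted_tree) filter" where
  "(uniformity :: (rooted_tree \<times> rooted_tree) filter) =
     (INF e\<in>{0<..}. principal {(x, y). dist x y < e})"

definition open_rooted_tree :: "rooted_tree set \<Rightarrow> bool" where
  "open (U :: rooted_tree set) \<longleftrightarrow> (\<forall>x\<in>U. \<forall>\<^sub>F (x', y) in uniformity. x' = x \<longrightarrow> y \<in> U)"

lemma dist_le_exp_iff: "dist s t \<le> exp (- real n) \<longleftrightarrow> trunc n s = trunc n t"
  for s t :: rooted_tree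
proof (cases "s = t")
  case False
  define P where "P = (\<lambda>n. trunc n s = trunc n t)"
  obtain b where b: "\<not> P b"
    using trunc_eqI False unfolding P_def by metis
  have le: "m < b" if "P m" for m
    using that b trunc_mono unfolding P_def by (metis not_le trunc_mono)
  have "P (Greatest P)"
    by (rule GreatestI_nat[of P 0 b]) (use le in \<open>auto simp: P_def less_imp_le\<close>)
  moreover have "m \<le> Greatest P" if "P m" for m
    by (rule Greatest_le_nat[of P m b]) (use that le in \<open>auto simp: less_imp_le\<close>)
  ultimately have "n \<le> Greatest P \<longleftrightarrow> P n"
    using trunc_mono unfolding P_def by blast
  then show ?thesis
    using False by (simp add: dist_rooted_tree_def P_def)
qed (simp add: dist_rooted_tree_def)

instance
proof
  fix x y z :: rooted_tree
  show "dist x y = 0 \<longleftrightarrow> x = y"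
    by (simp add: dist_rooted_tree_def)
  show "dist x y \<le> dist x z + dist y z"
  proof (cases "x = z \<or> y = z")
    case True
    moreover have "dist x y = dist y x"
      by (simp add: dist_rooted_tree_def eq_commute[of x y] eq_commute[of "trunc _ x" "trunc _ y"])
    moreover have "dist z z = 0"
      by (simp add: dist_rooted_tree_def)
    ultimately show ?thesis by auto
  next
    case False
    then obtain m n where mn: "dist x z = exp (- real m)" "dist y z = exp (- real n)"
      by (auto simp: dist_rooted_tree_def)
    then have "trunc (min m n) x = trunc (min m n) z" "trunc (min m n) y = trunc (min m n) z"
      using dist_le_exp_iff[of x z m] dist_le_exp_iff[of y z n]
        trunc_mono[of m x z "min m n"] trunc_mono[of n y z "min m n"] by simp_all
    then have "dist x y \<le> exp (- real (min m n))"
      by (simp add: dist_le_exp_iff)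
    also have "\<dots> \<le> exp (- real m) + exp (- real n)"
      by (cases "m \<le> n") (simp_all add: min_def)
    finally show ?thesis using mn by simp
  qed
qed (rule uniformity_rooted_tree_def open_rooted_tree_def)+

end

definition tree_of_children :: "(nat list \<Rightarrow> nat) \<Rightarrow> rooted_tree" where
  "tree_of_children \<nu> = Abs_rooted_tree {u. \<forall>i<length u. u ! i < \<nu> (take i u)}"

lemma vertices_tree_of_children:
  "vertices (tree_of_children \<nu>) = {u. \<forall>i<length u. u ! i < \<nu> (take i u)}"
proof -
  let ?t = "{u. \<forall>i<length u. u ! i < \<nu> (take i u)}"
  have snoc: "u @ [j] \<in> ?t \<longleftrightarrow> u \<in> ?t \<and> j < \<nu> u" for u j
    by (auto simp: nth_append less_Suc_eq)
  have "finite {j. u @ [j] \<in> ?t}" for u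
    by (rule finite_subset[of _ "{..<\<nu> u}"]) (unfold snoc, auto)
  moreover have "[] \<in> ?t" by simp
  moreover have "u @ [j] \<in> ?t \<Longrightarrow> u \<in> ?t" "u @ [j] \<in> ?t \<Longrightarrow> i < j \<Longrightarrow> u @ [i] \<in> ?t" for u i j
    unfolding snoc by auto
  ultimately show ?thesis
    unfolding tree_of_children_def
    by (intro Abs_rooted_tree_inverse CollectI[of _ ?t] conjI allI impI)
qed

definition regular_tree :: "nat \<Rightarrow> rooted_tree" where
  "regular_tree m = tree_of_children (\<lambda>_. m)"

text \<open>
  The law of the tree whose vertices have independent numbers of children, each with law \<open>L\<close>.
\<close>

definition galton_watson_law :: "nat measure \<Rightarrow> rooted_tree measure" where
  "galton_watson_law L = distr (\<Pi>\<^sub>M u\<in>UNIV. L) borel tree_of_children"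

definition galton_watson_tree ::
    "'b measure \<Rightarrow> ('b \<Rightarrow> nat) \<Rightarrow> 'a measure \<Rightarrow> ('a \<Rightarrow> rooted_tree) \<Rightarrow> bool" where
  "galton_watson_tree Q N M T \<longleftrightarrow>
     T \<in> M \<rightarrow>\<^sub>M borel \<and> distr M borel T = galton_watson_law (distr Q (count_space UNIV) N)"

lemma open_rooted_tree_trunc:
  fixes U :: "rooted_tree set"
  assumes "open U" "t \<in> U"
  obtains n where "{s. trunc n s = trunc n t} \<subseteq> U"
proof -
  obtain e where e: "e > 0" "\<And>s. dist s t < e \<Longrightarrow> s \<in> U"
    using assms by (auto simp: open_dist)
  obtain n :: nat where "- ln e < real n"
    using reals_Archimedean2 by blast
  then have "exp (- real n) < e"
    using e(1) by (metis exp_less_cancel_iff exp_ln minus_less_iff)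
  then have "{s. trunc n s = trunc n t} \<subseteq> U"
    using e(2) by (auto simp flip: dist_le_exp_iff)
  then show ?thesis by (rule that)
qed

text \<open>
  Measurability of \<^const>\<open>tree_of_children\<close>, without which \<^const>\<open>distr\<close> would not
  yield a probability measure in \<^const>\<open>galton_watson_law\<close>.
\<close>

lemma measurable_tree_of_children:
  assumes [measurable_cong]: "sets L = sets (count_space UNIV)"
  shows "tree_of_children \<in> (\<Pi>\<^sub>M u\<in>UNIV. L) \<rightarrow>\<^sub>M borel"
proof (rule borel_measurableI)
  fix U :: "rooted_tree set" assume U: "open U"
  let ?P = "\<Pi>\<^sub>M u\<in>(UNIV :: nat list set). L"
  let ?I = "{(n, A). finite A \<and> {s. trunc n s = A} \<subseteq> U}"
  have "U = (\<Union>(n, A)\<in>?I. {s. trunc n s = A})"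
  proof (intro equalityI subsetI)
    fix t assume "t \<in> U"
    then obtain n where "{s. trunc n s = trunc n t} \<subseteq> U"
      using open_rooted_tree_trunc[OF U] by blast
    then show "t \<in> (\<Union>(n, A)\<in>?I. {s. trunc n s = A})"
      using finite_trunc[of n t] by (intro UN_I[of "(n, trunc n t)"]) simp_all
  qed auto
  then have eq: "tree_of_children -` U \<inter> space ?P =
      (\<Union>(n, A)\<in>?I. {\<nu> \<in> space ?P. trunc n (tree_of_children \<nu>) = A})"
    by blast
  have "countable ({A :: nat list set. finite A})"
    using countable_Collect_finite by simp
  then have "countable ?I"
    by (intro countable_subset[of ?I "UNIV \<times> {A. finite A}"]) auto
  moreover have "{\<nu> \<in> space ?P. trunc n (tree_of_children \<nu>) = A} \<in> sets ?P" for n A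
    unfolding trunc_def vertices_tree_of_children set_eq_iff by measurable
  ultimately show "tree_of_children -` U \<inter> space ?P \<in> sets ?P"
    unfolding eq by (intro sets.countable_UN') auto
qed

lemma prob_space_galton_watson_law:
  assumes "prob_space L" "sets L = sets (count_space UNIV)"
  shows "prob_space (galton_watson_law L)"
  unfolding galton_watson_law_def
  by (intro prob_space.prob_space_distr prob_space_PiM measurable_tree_of_children assms)

definition conditional_law ::
    "'a measure \<Rightarrow> ('a \<Rightarrow> 'c::topological_space) \<Rightarrow> ('a \<Rightarrow> bool) \<Rightarrow> 'c measure" where
  "conditional_law M X E = distr (uniform_measure M {\<omega> \<in> space M. E \<omega>}) borel X"

definition converges_in_law ::
    "('i \<Rightarrow> 'c::topological_space measure) \<Rightarrow> 'c measure \<Rightarrow> 'i filter \<Rightarrow> bool" where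
  "converges_in_law \<kappa> \<kappa>' F \<longleftrightarrow>
     (\<forall>f :: 'c \<Rightarrow> real. continuous_on UNIV f \<longrightarrow> bounded (range f) \<longrightarrow>
        ((\<lambda>i. integral\<^sup>L (\<kappa> i) f) \<longlongrightarrow> integral\<^sup>L \<kappa>' f) F)"

end

(*
  By the branching property, W = (W_1 + ... + W_N) / a with independent copies W_i of W. As the
  W_i are nonnegative, W < x together with N > \<mu> forces W_1 + ... + W_\<mu> < a x and, independently,
  W_(\<mu>+1) < a x. Hence P(N > \<mu>, W < x) is at most P(W < x) P(W < a x) / P(N = \<mu>). By the
  Kesten-Stigum theorem W > 0 almost surely, so P(W < a x) tends to 0 and the root has \<mu> children
  with conditional probability tending to 1. Given this, the argument recurs in the \<mu> subtrees:
  conditioning on W_1 + ... + W_\<mu> < a x and on all W_j with j \<noteq> i leaves a condition of the form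
  W_i < y with y \<le> a x. Finally P(W < x) > 0, since with positive probability N = \<mu> and all W_i \<le> c,
  whence W \<le> c \<mu> / a, and \<mu> / a < 1 can be iterated.

  For the Kesten-Stigum theorem, the Laplace transforms of Z_n / a^n are bounded away from 1 by means
  of 1 - (1 - v)^m \<ge> m v (1 - min(1, m v)); so P(W = 0) < 1, and P(W = 0) is a fixed point of the
  generating function of N. The almost sure existence of W is Doob's upcrossing argument.
*)

theory Submission
  imports Defs
begin

subsection \<open>Resampling the coordinates of a product measure\<close>

text \<open>The obstacle is that W < x couples the subtrees of the root: given this event they are
  no longer independent. The recursion therefore avoids conditional laws and ratios. It carries an
  inequality P(bad, W < x) \<le> d * P(W < x), required for all x up to some y. Passing between W <
  x on N = \<mu> and the sum of the first \<mu> subtree limits costs exactly the constant factor P(N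
  = \<mu>).

  Independence is read off coordinates: all child counts, also those at words outside the tree, form
  one product space, and overwriting a set of coordinates by a fresh copy preserves the law.

  For positivity of W, the relative loss in passing from generation k to k + 1 is at most a multiple
  of E(N min(1, N t a^(k-n))). The minima run along a geometric scale, so their sum over k < n is
  dominated by a logarithm, uniformly in n; this uniformity is what lets the bound pass to
  W.\<close>

lemma measurable_override_on [measurable]:
  "(\<lambda>(x, y). override_on x y B) \<in> PiM UNIV K \<Otimes>\<^sub>M PiM UNIV K \<rightarrow>\<^sub>M PiM UNIV K"
proof (rule measurable_PiM_single)
  fix A i assume "i \<in> UNIV" and A: "A \<in> sets (K i)"
  have m: "(\<lambda>p. fst p i) \<in> PiM UNIV K \<Otimes>\<^sub>M PiM UNIV K \<rightarrow>\<^sub>M K i" "(\<lambda>p. snd p i) \<in> PiM UNIV K \<Otimes>\<^sub>M PiM UNIV K \<rightarrow>\<^sub>M K i"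
    by measurable
  show "{\<omega> \<in> space (PiM UNIV K \<Otimes>\<^sub>M PiM UNIV K). (case \<omega> of (x, y) \<Rightarrow> override_on x y B) i \<in> A}
      \<in> sets (PiM UNIV K \<Otimes>\<^sub>M PiM UNIV K)"
    using measurable_sets[OF m(1) A] measurable_sets[OF m(2) A]
    by (cases "i \<in> B") (simp_all add: override_on_def case_prod_beta vimage_def Int_def conj_commute)
qed (auto simp: space_pair_measure space_PiM override_on_def PiE_iff)

text \<open>A cylinder over \<open>J\<close> pulls back to a rectangle: coordinates in
  \<open>J - B\<close> come from the first copy, those in \<open>J \<inter> B\<close> from the
  second. Its measure is the same finite product, split in two.\<close>

lemma distr_override_on_PiM:
  assumes K: "\<And>i. prob_space (K i)"
  shows "distr (PiM UNIV K \<Otimes>\<^sub>M PiM UNIV K) (PiM UNIV K) (\<lambda>(x, y). override_on x y B) = PiM UNIV K"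
    (is "distr ?PP ?P ?f = _")
proof (rule measure_eqI_PiM_infinite[symmetric, OF refl])
  interpret P: prob_space ?P
    using K by (rule prob_space_PiM)
  show "finite_measure ?P"
    by unfold_locales
  fix A J assume J: "finite J" "J \<subseteq> UNIV" and A: "\<And>i. i \<in> J \<Longrightarrow> A i \<in> sets (K i)"
  let ?emb = "\<lambda>J. prod_emb UNIV K J (Pi\<^sub>E J A)"
  have *: "?f -` ?emb J \<inter> space ?PP = ?emb (J - B) \<times> ?emb (J \<inter> B)"
    using A sets.sets_into_space
    by (fastforce simp: prod_emb_def space_pair_measure space_PiM override_on_def PiE_iff split: if_splits)
  have "emeasure (distr ?PP ?P ?f) (?emb J) = emeasure ?P (?emb (J - B)) * emeasure ?P (?emb (J \<inter> B))"
    using J A by (subst emeasure_distr) (auto simp: * intro!: P.emeasure_pair_measure_Times sets_PiM_I)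
  also have "\<dots> = (\<Prod>i\<in>J - B. emeasure (K i) (A i)) * (\<Prod>i\<in>J \<inter> B. emeasure (K i) (A i))"
    using J A by (intro arg_cong2[where f = "(*)"] emeasure_PiM_emb K) auto
  also have "\<dots> = (\<Prod>i\<in>J. emeasure (K i) (A i))"
    using J(1) by (subst prod.union_disjoint[symmetric]) (auto intro!: prod.cong)
  also have "\<dots> = emeasure ?P (?emb J)"
    using J A by (intro emeasure_PiM_emb[symmetric] K) auto
  finally show "emeasure ?P (?emb J) = emeasure (distr ?PP ?P ?f) (?emb J)" ..
qed simp

text \<open>The outer variable supplies the coordinates in \<open>B\<close>, the inner one all
  others; taking the complement of \<open>B\<close> exchanges the two roles.\<close>

lemma nn_integral_resample:
  assumes K: "\<And>i. prob_space (K i)" and h [measurable]: "h \<in> borel_measurable (PiM UNIV K)"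
  shows "(\<integral>\<^sup>+x. h x \<partial>PiM UNIV K) = (\<integral>\<^sup>+y. \<integral>\<^sup>+x. h (override_on x y B) \<partial>PiM UNIV K \<partial>PiM UNIV K)"
proof -
  interpret P: prob_space "PiM UNIV K"
    using K by (rule prob_space_PiM)
  interpret PP: pair_sigma_finite "PiM UNIV K" "PiM UNIV K" ..
  have "(\<integral>\<^sup>+x. h x \<partial>PiM UNIV K) = (\<integral>\<^sup>+p. h (override_on (fst p) (snd p) B) \<partial>(PiM UNIV K \<Otimes>\<^sub>M PiM UNIV K))"
    by (subst distr_override_on_PiM[OF K, where B = B, symmetric])
      (simp add: nn_integral_distr case_prod_beta)
  also have "\<dots> = (\<integral>\<^sup>+y. \<integral>\<^sup>+x. h (override_on x y B) \<partial>PiM UNIV K \<partial>PiM UNIV K)"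
    using measurable_compose[OF measurable_override_on[of B K] h]
    by (subst PP.nn_integral_snd[symmetric]) (simp_all add: case_prod_beta)
  finally show ?thesis .
qed

text \<open>The two invariances say that \<open>f\<close> ignores the coordinates in
  \<open>B\<close> and that \<open>g\<close> reads no others. Independence is used in this form from
  here on.\<close>

lemma nn_integral_mult_resample:
  fixes f g :: "('i \<Rightarrow> 'a) \<Rightarrow> ennreal"
  assumes K: "\<And>i. prob_space (K i)"
    and [measurable]: "f \<in> borel_measurable (PiM UNIV K)" "g \<in> borel_measurable (PiM UNIV K)"
    and "\<And>x y. f (override_on x y B) = f x" "\<And>x y. g (override_on x y B) = g y"
  shows "(\<integral>\<^sup>+x. f x * g x \<partial>PiM UNIV K) = (\<integral>\<^sup>+x. f x \<partial>PiM UNIV K) * (\<integral>\<^sup>+x. g x \<partial>PiM UNIV K)"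
proof -
  have "(\<integral>\<^sup>+x. f x * g x \<partial>PiM UNIV K) = (\<integral>\<^sup>+y. \<integral>\<^sup>+x. f x * g y \<partial>PiM UNIV K \<partial>PiM UNIV K)"
    using assms by (subst nn_integral_resample[where B = B]) auto
  then show ?thesis
    by (simp add: nn_integral_multc nn_integral_cmult)
qed

subsection \<open>Trees and their subtrees\<close>

text \<open>Defined for every \<open>i\<close>, also when \<open>i \<ge> \<nu> []\<close> and the
  child is absent. Hence the shifted families are independent of the child count of the root, and
  sums over the first \<mu> of them make sense without a condition on the root.\<close>

definition subtree :: "nat \<Rightarrow> (nat list \<Rightarrow> 'a) \<Rightarrow> nat list \<Rightarrow> 'a" where
  "subtree i \<nu> = (\<lambda>w. \<nu> (i # w))"

abbreviation gen :: "nat \<Rightarrow> (nat list \<Rightarrow> nat) \<Rightarrow> nat" where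
  "gen n \<nu> \<equiv> generation_size (tree_of_children \<nu>) n"

lemma Cons_in_vertices_iff:
  "i # w \<in> vertices (tree_of_children \<nu>) \<longleftrightarrow> i < \<nu> [] \<and> w \<in> vertices (tree_of_children (subtree i \<nu>))"
  by (auto simp: vertices_tree_of_children subtree_def less_Suc_eq_0_disj)

lemma snoc_in_vertices_iff:
  "u @ [j] \<in> vertices (tree_of_children \<nu>) \<longleftrightarrow> u \<in> vertices (tree_of_children \<nu>) \<and> j < \<nu> u"
  by (auto simp: vertices_tree_of_children nth_append less_Suc_eq)

lemma Nil_in_vertices [simp]: "[] \<in> vertices t"
  using vertices[of t] by auto

lemma finite_generation: "finite {u \<in> vertices t. length u = n}"
  by (rule finite_subset[OF _ finite_trunc[of n t]]) (auto simp: trunc_def)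

lemma gen_0 [simp]: "gen 0 \<nu> = 1"
proof -
  have "{u \<in> vertices (tree_of_children \<nu>). length u = 0} = {[]}"
    by auto
  then show ?thesis by (simp add: generation_size_def)
qed

lemma gen_Suc: "gen (Suc n) \<nu> = (\<Sum>i<\<nu> []. gen n (subtree i \<nu>))"
proof -
  let ?G = "\<lambda>i. {w \<in> vertices (tree_of_children (subtree i \<nu>)). length w = n}"
  have "{u \<in> vertices (tree_of_children \<nu>). length u = Suc n} = (\<Union>i<\<nu> []. Cons i ` ?G i)"
    by (auto simp: Cons_in_vertices_iff length_Suc_conv image_iff)
  moreover have "card (\<Union>i<\<nu> []. Cons i ` ?G i) = (\<Sum>i<\<nu> []. card (Cons i ` ?G i))"
    by (rule card_UN_disjoint) (auto simp: finite_generation)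
  ultimately show ?thesis
    by (simp add: generation_size_def card_image)
qed

text \<open>Whereas \<open>gen_Suc\<close> splits at the root and serves the branching identities,
  this splits at the last generation: child counts at depth \<open>n\<close> are not read by
  generations up to \<open>n\<close>, which gives the martingale property.\<close>

lemma gen_Suc_last: "gen (Suc n) \<nu> = (\<Sum>u | u \<in> vertices (tree_of_children \<nu>) \<and> length u = n. \<nu> u)"
proof -
  let ?G = "{u \<in> vertices (tree_of_children \<nu>). length u = n}"
  have "{u \<in> vertices (tree_of_children \<nu>). length u = Suc n} = (\<Union>u\<in>?G. (\<lambda>j. u @ [j]) ` {..<\<nu> u})"
    by (auto simp: snoc_in_vertices_iff length_Suc_conv_rev image_iff)
  moreover have "card (\<Union>u\<in>?G. (\<lambda>j. u @ [j]) ` {..<\<nu> u}) = (\<Sum>u\<in>?G. card ((\<lambda>j. u @ [j]) ` {..<\<nu> u}))"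
    by (rule card_UN_disjoint) (auto simp: finite_generation)
  moreover have "card ((\<lambda>j. u @ [j]) ` {..<\<nu> u}) = \<nu> u" for u
    by (subst card_image) (auto simp: inj_on_def)
  ultimately show ?thesis
    by (simp add: generation_size_def)
qed

lemma vertices_cong_length:
  assumes "\<And>v. length v < n \<Longrightarrow> \<nu> v = \<nu>' v" "length u \<le> n"
  shows "u \<in> vertices (tree_of_children \<nu>) \<longleftrightarrow> u \<in> vertices (tree_of_children \<nu>')"
  using assms by (simp add: vertices_tree_of_children)

lemma gen_cong:
  assumes "\<And>v. length v < n \<Longrightarrow> \<nu> v = \<nu>' v" "k \<le> n"
  shows "gen k \<nu> = gen k \<nu>'"
proof -
  have "{u \<in> vertices (tree_of_children \<nu>). length u = k} = {u \<in> vertices (tree_of_children \<nu>'). length u = k}"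
    using vertices_cong_length[OF assms(1)] assms(2) by auto
  then show ?thesis by (simp add: generation_size_def)
qed

lemma trunc_Suc_eq_regular_iff:
  "trunc (Suc k) (tree_of_children \<nu>) = trunc (Suc k) (regular_tree m) \<longleftrightarrow>
    \<nu> [] = m \<and> (\<forall>i<m. trunc k (tree_of_children (subtree i \<nu>)) = trunc k (regular_tree m))"
proof -
  have reg: "i # w \<in> vertices (regular_tree m) \<longleftrightarrow> i < m \<and> w \<in> vertices (regular_tree m)" for i w
    unfolding regular_tree_def by (simp add: Cons_in_vertices_iff) (simp add: subtree_def)
  have trunc_iff: "trunc k s = trunc k t \<longleftrightarrow> (\<forall>w. length w \<le> k \<longrightarrow> (w \<in> vertices s \<longleftrightarrow> w \<in> vertices t))" for k s t
    by (auto simp: trunc_def)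
  have "trunc (Suc k) s = trunc (Suc k) t \<longleftrightarrow>
      (\<forall>i w. length w \<le> k \<longrightarrow> (i # w \<in> vertices s \<longleftrightarrow> i # w \<in> vertices t))" for s t
    unfolding trunc_iff by (metis Nil_in_vertices Suc_le_mono length_Cons list.exhaust)
  then have "trunc (Suc k) (tree_of_children \<nu>) = trunc (Suc k) (regular_tree m) \<longleftrightarrow>
      (\<forall>i w. length w \<le> k \<longrightarrow> (i < \<nu> [] \<and> w \<in> vertices (tree_of_children (subtree i \<nu>)) \<longleftrightarrow>
        i < m \<and> w \<in> vertices (regular_tree m)))" (is "_ \<longleftrightarrow> ?R")
    by (simp add: Cons_in_vertices_iff reg)
  also have "?R \<longleftrightarrow> \<nu> [] = m \<and> (\<forall>i<m. trunc k (tree_of_children (subtree i \<nu>)) = trunc k (regular_tree m))"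
  proof
    assume R: ?R
    then have "i < \<nu> [] \<longleftrightarrow> i < m" for i
      using spec[OF spec[OF R, of i], of "[]"] by simp
    then have "\<nu> [] = m"
      by (metis linorder_neqE_nat less_irrefl)
    with R show "\<nu> [] = m \<and> (\<forall>i<m. trunc k (tree_of_children (subtree i \<nu>)) = trunc k (regular_tree m))"
      by (auto simp: trunc_iff)
  qed (auto simp: trunc_iff)
  finally show ?thesis .
qed

text \<open>Trees at distance below exp(-n) share their truncation at \<open>n\<close>, so a
  property of the truncation is locally constant.\<close>

lemma open_trunc_eq: "open {t. R (trunc n t)}"
  unfolding open_dist
proof (intro ballI exI conjI allI impI)
  fix s t :: rooted_tree assume "s \<in> {t. R (trunc n t)}" "dist t s < exp (- real n)"
  then show "t \<in> {t. R (trunc n t)}"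
    using dist_le_exp_iff[of t s n] by simp
qed simp

lemma measurable_generation_size [measurable]:
  "(\<lambda>t. generation_size t n) \<in> borel \<rightarrow>\<^sub>M count_space UNIV"
proof (rule measurable_count_space_eq2_countable[THEN iffD2], safe)
  fix k
  have *: "generation_size t n = card {u \<in> trunc n t. length u = n}" for t
    by (auto simp: generation_size_def trunc_def intro!: arg_cong[where f = card])
  have "open {t. generation_size t n = k}"
    unfolding * by (rule open_trunc_eq)
  then show "(\<lambda>t. generation_size t n) -` {k} \<inter> space borel \<in> sets borel"
    by (auto simp: vimage_def)
qed auto

section \<open>Independence of the root and its subtrees on the space of child counts\<close>

locale offspring = prob_space L for L :: "nat measure" +
  assumes sets_L [measurable_cong]: "sets L = sets (count_space UNIV)"
begin

abbreviation P :: "(nat list \<Rightarrow> nat) measure" where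
  "P \<equiv> \<Pi>\<^sub>M u\<in>UNIV. L"

lemma space_L [simp]: "space L = UNIV"
  using sets_eq_imp_space_eq[OF sets_L] by simp

lemma space_P [simp]: "space P = UNIV"
  by (simp add: space_PiM)

sublocale P: prob_space P
  by (rule prob_space_PiM) unfold_locales

lemmas prob_UNIV [simp] = prob_space[simplified] P.prob_space[simplified]

lemma sets_P_Collect: "Measurable.pred P R \<Longrightarrow> {\<nu>. R \<nu>} \<in> sets P"
  by (simp add: pred_def)

lemma measurable_tree [measurable]: "tree_of_children \<in> P \<rightarrow>\<^sub>M borel"
  by (rule measurable_tree_of_children[OF sets_L])

lemma measurable_subtree [measurable]: "subtree i \<in> P \<rightarrow>\<^sub>M P"
  unfolding subtree_def by (rule measurable_PiM_single') (auto simp: space_PiM)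

lemma measurable_children [measurable]: "(\<lambda>\<nu>. \<nu> u) \<in> P \<rightarrow>\<^sub>M count_space UNIV"
  by measurable

text \<open>\<open>Cons i\<close> is injective, and reindexing an i.i.d. family along an injection
  gives an i.i.d. family with the same marginals.\<close>

lemma distr_subtree: "distr P P (subtree i) = P"
  using distr_PiM_reindex[of UNIV "\<lambda>_. L" "Cons i" UNIV] prob_space_axioms
  by (simp add: subtree_def[abs_def] inj_on_def restrict_def)

lemma distr_children: "distr P L (\<lambda>\<nu>. \<nu> u) = L"
  using distr_PiM_component[of UNIV "\<lambda>_. L" u] prob_space_axioms by simp

lemma nn_integral_subtree:
  assumes [measurable]: "g \<in> borel_measurable P"
  shows "(\<integral>\<^sup>+\<nu>. g (subtree i \<nu>) \<partial>P) = (\<integral>\<^sup>+\<nu>. g \<nu> \<partial>P)"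
  by (subst (2) distr_subtree[of i, symmetric]) (simp add: nn_integral_distr)

lemma AE_subtree:
  assumes "AE \<nu> in P. R \<nu>"
  shows "AE \<nu> in P. R (subtree i \<nu>)"
  using assms by (subst (asm) distr_subtree[of i, symmetric]) (rule AE_distrD[OF measurable_subtree])

lemma subtree_override_on [simp]:
  "subtree i (override_on \<nu> \<xi> (range (Cons i))) = subtree i \<xi>"
  "i \<noteq> j \<Longrightarrow> subtree j (override_on \<nu> \<xi> (range (Cons i))) = subtree j \<nu>"
  "override_on \<nu> \<xi> (range (Cons i)) [] = \<nu> []"
  "subtree j (override_on \<nu> \<xi> {[]}) = subtree j \<nu>"
  "override_on \<nu> \<xi> {[]} [] = \<xi> []"
  by (auto simp: subtree_def override_on_def)

lemma nn_integral_mult_subtree: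
  assumes "f \<in> borel_measurable P" "g \<in> borel_measurable P"
    and "\<And>\<nu> \<xi>. f (override_on \<nu> \<xi> (range (Cons i))) = f \<nu>"
  shows "(\<integral>\<^sup>+\<nu>. f \<nu> * g (subtree i \<nu>) \<partial>P) = (\<integral>\<^sup>+\<nu>. f \<nu> \<partial>P) * (\<integral>\<^sup>+\<nu>. g \<nu> \<partial>P)"
  using nn_integral_mult_resample[of "\<lambda>_. L" f "\<lambda>\<nu>. g (subtree i \<nu>)" "range (Cons i)"] assms
    prob_space_axioms
  by (simp add: nn_integral_subtree)

lemma nn_integral_prod_subtrees:
  assumes [measurable]: "\<And>i. g i \<in> borel_measurable P"
  shows "(\<integral>\<^sup>+\<nu>. h (\<nu> []) * (\<Prod>i<m. g i (subtree i \<nu>)) \<partial>P) = (\<integral>\<^sup>+\<nu>. h (\<nu> []) \<partial>P) * (\<Prod>i<m. \<integral>\<^sup>+\<nu>. g i \<nu> \<partial>P)"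
proof (induction m)
  case (Suc m)
  have "(\<integral>\<^sup>+\<nu>. h (\<nu> []) * (\<Prod>i<Suc m. g i (subtree i \<nu>)) \<partial>P) =
      (\<integral>\<^sup>+\<nu>. (h (\<nu> []) * (\<Prod>i<m. g i (subtree i \<nu>))) * g m (subtree m \<nu>) \<partial>P)"
    by (simp add: mult_ac)
  also have "\<dots> = (\<integral>\<^sup>+\<nu>. h (\<nu> []) * (\<Prod>i<m. g i (subtree i \<nu>)) \<partial>P) * (\<integral>\<^sup>+\<nu>. g m \<nu> \<partial>P)"
    by (rule nn_integral_mult_subtree) (auto intro!: prod.cong arg_cong2[where f = "(*)"])
  finally show ?case
    by (simp add: Suc mult_ac)
qed simp

text \<open>The number of factors is random. Resampling the root coordinate alone freezes it, after
  which the subtrees factorise.\<close>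

lemma nn_integral_branching:
  assumes [measurable]: "g \<in> borel_measurable P"
  shows "(\<integral>\<^sup>+\<nu>. (\<Prod>i<\<nu> []. g (subtree i \<nu>)) \<partial>P) = (\<integral>\<^sup>+\<nu>. (\<integral>\<^sup>+\<nu>. g \<nu> \<partial>P) ^ \<nu> [] \<partial>P)"
proof -
  have *: "(\<lambda>\<nu>. \<Prod>i<\<nu> []. g (subtree i \<nu>)) \<in> borel_measurable P"
    by (rule measurable_compose_countable[where g = "\<lambda>\<nu>. \<nu> []"]) measurable
  have "(\<integral>\<^sup>+\<nu>. (\<Prod>i<\<nu> []. g (subtree i \<nu>)) \<partial>P) = (\<integral>\<^sup>+\<xi>. \<integral>\<^sup>+\<nu>. (\<Prod>i<\<xi> []. g (subtree i \<nu>)) \<partial>P \<partial>P)"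
    by (subst nn_integral_resample[OF prob_space_axioms *, where B = "{[]}"]) simp
  moreover have "(\<integral>\<^sup>+\<nu>. (\<Prod>i<m. g (subtree i \<nu>)) \<partial>P) = (\<integral>\<^sup>+\<nu>. g \<nu> \<partial>P) ^ m" for m
    using nn_integral_prod_subtrees[of "\<lambda>_. g" "\<lambda>_. 1" m] by (simp add: P.emeasure_space_1[simplified])
  ultimately show ?thesis
    by simp
qed

lemma measurable_gen [measurable]: "gen n \<in> P \<rightarrow>\<^sub>M count_space UNIV"
  by (rule measurable_compose[OF measurable_tree measurable_generation_size])

end

subsection \<open>Convergence of nonnegative supermartingales\<close>

text \<open>
  The strategy of Doob's upcrossing argument: buy below \<open>\<alpha>\<close>, sell above \<open>\<beta>\<close>. Each sale gains at least
  \<open>\<beta> - \<alpha>\<close>, and since \<open>x \<ge> 0\<close> the open position never loses more than \<open>\<alpha>\<close>.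
\<close>

primrec holding :: "real \<Rightarrow> real \<Rightarrow> (nat \<Rightarrow> real) \<Rightarrow> nat \<Rightarrow> bool" where
  "holding \<alpha> \<beta> x 0 \<longleftrightarrow> x 0 < \<alpha>"
| "holding \<alpha> \<beta> x (Suc n) \<longleftrightarrow> (if holding \<alpha> \<beta> x n then x (Suc n) \<le> \<beta> else x (Suc n) < \<alpha>)"

definition sells :: "real \<Rightarrow> real \<Rightarrow> (nat \<Rightarrow> real) \<Rightarrow> nat \<Rightarrow> bool" where
  "sells \<alpha> \<beta> x n \<longleftrightarrow> holding \<alpha> \<beta> x n \<and> \<not> holding \<alpha> \<beta> x (Suc n)"

lemma holding_cong:
  assumes "\<And>k. k \<le> n \<Longrightarrow> x k = y k"
  shows "holding \<alpha> \<beta> x n = holding \<alpha> \<beta> y n"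
  using assms by (induction n) auto

lemma measurable_holding [measurable]:
  assumes [measurable]: "\<And>n. X n \<in> borel_measurable M"
  shows "Measurable.pred M (\<lambda>\<omega>. holding \<alpha> \<beta> (\<lambda>n. X n \<omega>) n)"
proof (induction n)
  case (Suc n)
  note Suc [measurable]
  show ?case
    unfolding holding.simps by measurable
qed simp

lemma gain_ge:
  assumes "\<And>n. 0 \<le> x n" "0 \<le> \<alpha>"
  shows "(\<beta> - \<alpha>) * (\<Sum>k<n. of_bool (sells \<alpha> \<beta> x k)) - \<alpha>
    \<le> (\<Sum>k<n. of_bool (holding \<alpha> \<beta> x k) * (x (Suc k) - x k))"
proof -
  let ?g = "(\<Sum>k<n. of_bool (holding \<alpha> \<beta> x k) * (x (Suc k) - x k))"
  \<comment> \<open>The induction needs the open position as an extra term: it was bought below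
    \<alpha>, so at time \<open>n\<close> it has gained at least
    \<open>x n - \<alpha>\<close>.\<close>
  have "(\<beta> - \<alpha>) * (\<Sum>k<n. of_bool (sells \<alpha> \<beta> x k))
      + (if holding \<alpha> \<beta> x n then x n - \<alpha> else 0) \<le> ?g"
  proof (induction n)
    case (Suc n)
    then show ?case
      by (cases "holding \<alpha> \<beta> x n"; cases "holding \<alpha> \<beta> x (Suc n)") (auto simp: sells_def algebra_simps)
  qed (use assms in auto)
  moreover have "- \<alpha> \<le> (if holding \<alpha> \<beta> x n then x n - \<alpha> else 0)"
    using assms by simp
  ultimately show ?thesis
    by linarith
qed

text \<open>After the last sale, a value below \<alpha> opens a position that is never closed, but
  holding forbids values above \<beta>.\<close>

lemma frequently_sells:
  assumes "\<alpha> < \<beta>" "\<exists>\<^sub>F n in sequentially. x n < \<alpha>" "\<exists>\<^sub>F n in sequentially. \<beta> < x n"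
  shows "\<exists>\<^sub>F n in sequentially. sells \<alpha> \<beta> x n"
proof (rule ccontr)
  assume "\<not> (\<exists>\<^sub>F n in sequentially. sells \<alpha> \<beta> x n)"
  then obtain m where m: "\<And>n. n \<ge> m \<Longrightarrow> \<not> sells \<alpha> \<beta> x n"
    by (auto simp: not_frequently eventually_sequentially)
  obtain i where i: "i \<ge> m" "x i < \<alpha>"
    using assms(2) by (auto simp: frequently_sequentially)
  have "holding \<alpha> \<beta> x i"
    using i(2) assms(1) by (cases i) auto
  then have h: "holding \<alpha> \<beta> x (i + k)" for k
  proof (induction k)
    case (Suc k)
    with m[of "i + k"] i(1) show ?case
      by (simp add: sells_def)
  qed simp
  obtain j where j: "j \<ge> Suc i" "\<beta> < x j"
    using assms(3) by (auto simp: frequently_sequentially)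
  then obtain k where "j = Suc (i + k)"
    by (auto simp: le_iff_add)
  with h[of k] h[of "Suc k"] j(2) show False
    by simp
qed

text \<open>A gap between lower and upper limit would contain two rationals crossed infinitely
  often. Rational levels keep the exceptional null sets countable in number; the finite lower limit
  rules out divergence to infinity.\<close>

lemma convergent_ennreal_if_no_oscillation:
  fixes x :: "nat \<Rightarrow> real"
  assumes x: "\<And>n. 0 \<le> x n" and fin: "liminf (\<lambda>n. ennreal (x n)) < \<infinity>"
    and osc: "\<And>\<alpha> \<beta> :: rat. 0 \<le> \<alpha> \<Longrightarrow> \<alpha> < \<beta> \<Longrightarrow>
      \<not> ((\<exists>\<^sub>F n in sequentially. x n < of_rat \<alpha>) \<and> (\<exists>\<^sub>F n in sequentially. of_rat \<beta> < x n))"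
  shows "convergent x"
proof -
  let ?l = "liminf (\<lambda>n. ennreal (x n))" and ?u = "limsup (\<lambda>n. ennreal (x n))"
  have "\<not> ?l < ?u"
  proof
    assume "?l < ?u"
    then obtain c d where cd: "?l < c" "c < d" "d < ?u"
      using dense by metis
    then have "c < top" "d < top"
      using order_less_le_trans[OF _ top_greatest] by blast+
    then obtain c' d' where c': "c = ennreal c'" "d = ennreal d'" "0 \<le> c'" "0 \<le> d'"
      by (metis enn2real_nonneg ennreal_enn2real)
    then have "c' < d'"
      using cd(2) by (simp add: ennreal_less_iff)
    then obtain \<alpha> where \<alpha>: "c' < of_rat \<alpha>" "of_rat \<alpha> < d'"
      using of_rat_dense by blast
    then obtain \<beta> where \<beta>: "of_rat \<alpha> < (of_rat \<beta> :: real)" "of_rat \<beta> < d'"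
      using of_rat_dense by blast
    have "\<exists>\<^sub>F n in sequentially. x n < of_rat \<alpha>"
    proof (rule ccontr)
      assume "\<not> (\<exists>\<^sub>F n in sequentially. x n < of_rat \<alpha>)"
      then have "\<forall>\<^sub>F n in sequentially. c \<le> ennreal (x n)"
        unfolding not_frequently c' by (rule eventually_mono) (use \<alpha> in \<open>auto intro!: ennreal_leI\<close>)
      then show False
        using Liminf_bounded cd(1) by (metis not_le)
    qed
    moreover have "\<exists>\<^sub>F n in sequentially. of_rat \<beta> < x n"
    proof (rule ccontr)
      assume "\<not> (\<exists>\<^sub>F n in sequentially. of_rat \<beta> < x n)"
      then have "\<forall>\<^sub>F n in sequentially. ennreal (x n) \<le> d"
        unfolding not_frequently c' by (rule eventually_mono) (use \<beta> in \<open>auto intro!: ennreal_leI\<close>)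
      then show False
        using Limsup_bounded cd(3) by (metis not_le)
    qed
    moreover have "0 \<le> \<alpha>" "\<alpha> < \<beta>"
      using \<alpha>(1) c'(3) \<beta>(1) by (auto simp: of_rat_less) (metis le_less_trans less_imp_le zero_less_of_rat_iff)
    ultimately show False
      using osc by blast
  qed
  then have "?l = ?u"
    using Liminf_le_Limsup[of sequentially "\<lambda>n. ennreal (x n)"] by (simp add: not_less antisym)
  then have "(\<lambda>n. ennreal (x n)) \<longlonglongrightarrow> ennreal (enn2real ?l)"
    using fin by (intro Liminf_eq_Limsup) auto
  then have "x \<longlonglongrightarrow> enn2real ?l"
    by (rule tendsto_ennrealD) (auto simp: x)
  then show ?thesis
    by (rule convergentI)
qed

text \<open>The supermartingale property is tested on events determined by the first values of the
  process, in place of a filtration and conditional expectations. The events of holding a position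
  are of this kind.\<close>

lemma (in prob_space) nonneg_supermartingale_convergent:
  fixes X :: "nat \<Rightarrow> 'a \<Rightarrow> real"
  assumes int: "\<And>n. integrable M (X n)" and nonneg: "\<And>n \<omega>. 0 \<le> X n \<omega>"
    and super: "\<And>n R. Measurable.pred M R \<Longrightarrow>
      (\<And>\<omega> \<omega>'. (\<And>k. k \<le> n \<Longrightarrow> X k \<omega> = X k \<omega>') \<Longrightarrow> R \<omega> = R \<omega>') \<Longrightarrow>
      (\<integral>\<omega>. of_bool (R \<omega>) * X (Suc n) \<omega> \<partial>M) \<le> (\<integral>\<omega>. of_bool (R \<omega>) * X n \<omega> \<partial>M)"
  shows "AE \<omega> in M. convergent (\<lambda>n. X n \<omega>)"
proof -
  have [measurable]: "X n \<in> borel_measurable M" for n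
    using int by auto
  have sells: "AE \<omega> in M. \<forall>\<^sub>F n in sequentially. \<not> sells \<alpha> \<beta> (\<lambda>n. X n \<omega>) n"
    if ab: "0 \<le> \<alpha>" "\<alpha> < \<beta>" for \<alpha> \<beta>
  proof -
    let ?H = "\<lambda>k \<omega>. holding \<alpha> \<beta> (\<lambda>n. X n \<omega>) k"
    let ?A = "\<lambda>k. {\<omega> \<in> space M. sells \<alpha> \<beta> (\<lambda>n. X n \<omega>) k}"
    have [measurable]: "Measurable.pred M (\<lambda>\<omega>. sells \<alpha> \<beta> (\<lambda>n. X n \<omega>) k)" for k
      unfolding sells_def by measurable
    have intH: "integrable M (\<lambda>\<omega>. of_bool (?H k \<omega>) * X n \<omega>)" for k n
      by (rule Bochner_Integration.integrable_bound[OF int[of n]]) auto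
    \<comment> \<open>The expected gain of the strategy is at most 0, so the expected number of
      sales is bounded independently of \<open>n\<close>, and Borel-Cantelli leaves only finitely
      many.\<close>
    have "(\<Sum>k<n. prob (?A k)) \<le> \<alpha> / (\<beta> - \<alpha>)" for n
    proof -
      have intA: "integrable M (\<lambda>\<omega>. of_bool (sells \<alpha> \<beta> (\<lambda>n. X n \<omega>) k) :: real)" for k
        by (rule integrable_const_bound[where B = 1]) auto
      have "(\<beta> - \<alpha>) * (\<Sum>k<n. prob (?A k)) - \<alpha> =
          (\<integral>\<omega>. (\<beta> - \<alpha>) * (\<Sum>k<n. of_bool (sells \<alpha> \<beta> (\<lambda>n. X n \<omega>) k)) - \<alpha> \<partial>M)"
      proof -
        have "(\<integral>\<omega>. of_bool (sells \<alpha> \<beta> (\<lambda>n. X n \<omega>) k) \<partial>M) = prob (?A k)" for k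
          by (subst Bochner_Integration.integral_cong[where g = "indicator (?A k)"])
            (auto simp: indicator_def)
        then show ?thesis
          using intA by (simp add: prob_space del: sum_of_bool_eq)
      qed
      also have "\<dots> \<le> (\<integral>\<omega>. (\<Sum>k<n. of_bool (?H k \<omega>) * (X (Suc k) \<omega> - X k \<omega>)) \<partial>M)"
        using intA intH nonneg ab by (intro integral_mono gain_ge) (auto simp: right_diff_distrib simp del: sum_of_bool_eq)
      also have "\<dots> = (\<Sum>k<n. (\<integral>\<omega>. of_bool (?H k \<omega>) * X (Suc k) \<omega> \<partial>M) - (\<integral>\<omega>. of_bool (?H k \<omega>) * X k \<omega> \<partial>M))"
        using intH by (simp add: right_diff_distrib)
      also have "\<dots> \<le> 0"
        by (intro sum_nonpos) (auto intro!: super holding_cong)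
      finally show ?thesis
        using ab by (simp add: field_simps)
    qed
    then have "summable (\<lambda>k. prob (?A k))"
      by (intro summableI_nonneg_bounded) auto
    then have "AE \<omega> in M. \<forall>\<^sub>F k in sequentially. \<omega> \<in> space M - ?A k"
      by (intro borel_cantelli_AE1) (auto simp: emeasure_eq_measure)
    then show ?thesis
      by (rule AE_mp) (auto intro!: AE_I2 elim: eventually_mono)
  qed
  have "AE \<omega> in M. \<forall>\<alpha> \<beta> :: rat. 0 \<le> \<alpha> \<longrightarrow> \<alpha> < \<beta> \<longrightarrow>
      (\<forall>\<^sub>F n in sequentially. \<not> sells (of_rat \<alpha>) (of_rat \<beta>) (\<lambda>n. X n \<omega>) n)"
    using sells by (simp add: AE_all_countable of_rat_less)
  \<comment> \<open>By Fatou, since the means are bounded by the initial one.\<close>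
  moreover have "AE \<omega> in M. liminf (\<lambda>n. ennreal (X n \<omega>)) \<noteq> \<infinity>"
  proof (rule nn_integral_PInf_AE)
    have "(\<integral>\<^sup>+\<omega>. X n \<omega> \<partial>M) \<le> ennreal (\<integral>\<omega>. X 0 \<omega> \<partial>M)" for n
    proof (induction n)
      case (Suc n)
      have "(\<integral>\<omega>. X (Suc n) \<omega> \<partial>M) \<le> (\<integral>\<omega>. X n \<omega> \<partial>M)"
        using super[of "\<lambda>_. True" n] by simp
      then have "(\<integral>\<^sup>+\<omega>. X (Suc n) \<omega> \<partial>M) \<le> (\<integral>\<^sup>+\<omega>. X n \<omega> \<partial>M)"
        using int nonneg by (simp add: nn_integral_eq_integral ennreal_leI)
      with Suc show ?case by simp
    qed (simp add: nn_integral_eq_integral int nonneg)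
    then have "liminf (\<lambda>n. \<integral>\<^sup>+\<omega>. X n \<omega> \<partial>M) \<le> ennreal (\<integral>\<omega>. X 0 \<omega> \<partial>M)"
      by (intro Liminf_le) auto
    then have "(\<integral>\<^sup>+\<omega>. liminf (\<lambda>n. ennreal (X n \<omega>)) \<partial>M) \<le> ennreal (\<integral>\<omega>. X 0 \<omega> \<partial>M)"
      by (intro order_trans[OF nn_integral_liminf]) auto
    then show "(\<integral>\<^sup>+\<omega>. liminf (\<lambda>n. ennreal (X n \<omega>)) \<partial>M) \<noteq> \<infinity>"
      by (auto simp: top_unique)
  qed measurable
  ultimately show ?thesis
  proof eventually_elim
    case (elim \<omega>)
    show ?case
    proof (rule convergent_ennreal_if_no_oscillation)
      fix \<alpha> \<beta> :: rat assume ab: "0 \<le> \<alpha>" "\<alpha> < \<beta>"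
      then show "\<not> ((\<exists>\<^sub>F n in sequentially. X n \<omega> < of_rat \<alpha>) \<and> (\<exists>\<^sub>F n in sequentially. of_rat \<beta> < X n \<omega>))"
        using elim(1) frequently_sells[of "of_rat \<alpha>" "of_rat \<beta>" "\<lambda>n. X n \<omega>"]
        by (auto simp: of_rat_less frequently_def)
    qed (use nonneg elim(2) in \<open>auto simp: less_top\<close>)
  qed
qed

subsection \<open>The martingale limit\<close>

text \<open>\<mu> is characterised as the minimum of the support by \<open>prob_\<mu>\<close> and
  \<open>AE_ge_\<mu>\<close>; nondegeneracy enters as \<open>\<mu>_less_a\<close>.\<close>

locale galton_watson = offspring +
  fixes a :: real and \<mu> :: nat
  assumes integrable_L: "integrable L real"
    and a_eq: "a = (\<integral>n. real n \<partial>L)"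
    and \<mu>_ge_1: "1 \<le> \<mu>"
    and prob_\<mu>: "0 < prob {\<mu>}"
    and AE_ge_\<mu>: "AE n in L. \<mu> \<le> n"
    and \<mu>_less_a: "real \<mu> < a"
    and integrable_n_ln_n: "integrable L (\<lambda>n. real n * ln (real n))"
begin

text \<open>A function of the tree alone, so that probabilities of its events depend only on the law
  of the tree. Where the quotients do not converge, \<open>lim\<close> is an unspecified real;
  \<open>AE_tendsto_W\<close> makes this a null set.\<close>

definition limit_of :: "rooted_tree \<Rightarrow> real" where
  "limit_of t = lim (\<lambda>n. real (generation_size t n) / a ^ n)"

abbreviation W :: "(nat list \<Rightarrow> nat) \<Rightarrow> real" where
  "W \<nu> \<equiv> limit_of (tree_of_children \<nu>)"

lemma a_gt_1: "1 < a"
  using \<mu>_ge_1 \<mu>_less_a by simp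

lemma a_pow_pos [simp]: "0 < a ^ n"
  using a_gt_1 by simp

lemma measurable_limit_of [measurable]: "limit_of \<in> borel_measurable borel"
  unfolding limit_of_def by measurable

lemma nn_integral_children: "(\<integral>\<^sup>+\<nu>. real (\<nu> u) \<partial>P) = ennreal a"
proof -
  have "(\<integral>\<^sup>+\<nu>. real (\<nu> u) \<partial>P) = (\<integral>\<^sup>+n. real n \<partial>distr P L (\<lambda>\<nu>. \<nu> u))"
    by (simp add: nn_integral_distr)
  then show ?thesis
    using integrable_L by (simp add: distr_children nn_integral_eq_integral a_eq)
qed

lemma measurable_vertices [measurable]:
  "Measurable.pred P (\<lambda>\<nu>. u \<in> vertices (tree_of_children \<nu>))"
  unfolding vertices_tree_of_children by measurable

text \<open>Whether a word of length \<open>n\<close> is a vertex depends only on child counts at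
  its proper prefixes. Its own child count is thus independent of that and of \<open>R\<close>, and
  contributes the factor \<open>a\<close>.\<close>

lemma nn_integral_gen_Suc:
  assumes [measurable]: "Measurable.pred P R"
    and R: "\<And>\<nu> \<nu>'. (\<And>k. k \<le> n \<Longrightarrow> gen k \<nu> = gen k \<nu>') \<Longrightarrow> R \<nu> = R \<nu>'"
  shows "(\<integral>\<^sup>+\<nu>. of_bool (R \<nu>) * ennreal (real (gen (Suc n) \<nu>)) \<partial>P) =
    ennreal a * (\<integral>\<^sup>+\<nu>. of_bool (R \<nu>) * ennreal (real (gen n \<nu>)) \<partial>P)"
proof -
  let ?S = "{u :: nat list. length u = n}"
  let ?V = "\<lambda>u \<nu>. u \<in> vertices (tree_of_children \<nu>)"
  \<comment> \<open>The sum over the random generation becomes an integral over the countable set of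
    all words of length \<open>n\<close>, which can be interchanged with the expectation.\<close>
  have swap: "(\<integral>\<^sup>+\<nu>. of_bool (R \<nu>) * ennreal (real (\<Sum>u | ?V u \<nu> \<and> length u = n. f u \<nu>)) \<partial>P) =
      (\<integral>\<^sup>+u. \<integral>\<^sup>+\<nu>. of_bool (R \<nu>) * of_bool (?V u \<nu>) * ennreal (real (f u \<nu>)) \<partial>P \<partial>count_space ?S)"
    if [measurable]: "\<And>u. f u \<in> P \<rightarrow>\<^sub>M count_space UNIV" for f :: "nat list \<Rightarrow> (nat list \<Rightarrow> nat) \<Rightarrow> nat"
  proof -
    have "of_bool (R \<nu>) * ennreal (\<Sum>u | ?V u \<nu> \<and> length u = n. f u \<nu>) =
        (\<integral>\<^sup>+u. of_bool (R \<nu>) * of_bool (?V u \<nu>) * ennreal (real (f u \<nu>)) \<partial>count_space ?S)" for \<nu>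
    proof -
      have "(\<integral>\<^sup>+u. of_bool (R \<nu>) * of_bool (?V u \<nu>) * ennreal (real (f u \<nu>)) \<partial>count_space ?S) =
          (\<Sum>u | ?V u \<nu> \<and> length u = n. of_bool (R \<nu>) * of_bool (?V u \<nu>) * ennreal (f u \<nu>))"
        by (rule nn_integral_count_space') (auto simp: finite_generation)
      also have "\<dots> = (\<Sum>u | ?V u \<nu> \<and> length u = n. of_bool (R \<nu>) * ennreal (f u \<nu>))"
        by (rule sum.cong) auto
      finally show ?thesis
        by (simp add: sum_distrib_left[symmetric])
    qed
    then show ?thesis
      by (simp add: nn_integral_count_space_nn_integral)
  qed
  have "(\<integral>\<^sup>+\<nu>. of_bool (R \<nu>) * of_bool (?V u \<nu>) * ennreal (real (\<nu> u)) \<partial>P) =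
      ennreal a * (\<integral>\<^sup>+\<nu>. of_bool (R \<nu>) * of_bool (?V u \<nu>) \<partial>P)" if u: "u \<in> ?S" for u
  proof -
    \<comment> \<open>Overwriting the child count at a word of length \<open>n\<close> is invisible
      to the generations up to \<open>n\<close>.\<close>
    have eq: "override_on \<nu> \<xi> {u} v = \<nu> v" if "length v < n" for \<nu> \<xi> v
      using u that by (auto simp: override_on_def)
    have "R (override_on \<nu> \<xi> {u}) = R \<nu>" for \<nu> \<xi>
      by (rule R) (rule gen_cong[OF eq])
    moreover have "?V u (override_on \<nu> \<xi> {u}) = ?V u \<nu>" for \<nu> \<xi>
      using u by (intro vertices_cong_length[of n] eq) auto
    ultimately show ?thesis
      by (subst nn_integral_mult_resample[where B = "{u}"])
        (simp_all add: prob_space_axioms nn_integral_children mult.commute)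
  qed
  then show ?thesis
    unfolding gen_Suc_last
    using swap[of "\<lambda>u \<nu>. \<nu> u"] swap[of "\<lambda>u \<nu>. 1"]
    by (simp add: generation_size_def nn_integral_cmult cong: nn_integral_cong_simp)
qed

lemma nn_integral_gen: "(\<integral>\<^sup>+\<nu>. real (gen n \<nu>) \<partial>P) = ennreal (a ^ n)"
proof (induction n)
  case (Suc n)
  then show ?case
    using nn_integral_gen_Suc[of "\<lambda>_. True" n] a_gt_1 by (simp add: ennreal_mult)
qed (simp add: P.emeasure_space_1[simplified])

lemma integrable_gen: "integrable P (\<lambda>\<nu>. real (gen n \<nu>))"
  by (rule integrableI_nn_integral_finite[OF _ _ nn_integral_gen]) auto

lemma integral_gen: "(\<integral>\<nu>. real (gen n \<nu>) \<partial>P) = a ^ n"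
  by (rule integral_eq_nn_integral[THEN trans]) (auto simp: nn_integral_gen less_imp_le)

lemma integral_gen_Suc:
  assumes [measurable]: "Measurable.pred P R"
    and R: "\<And>\<nu> \<nu>'. (\<And>k. k \<le> n \<Longrightarrow> gen k \<nu> = gen k \<nu>') \<Longrightarrow> R \<nu> = R \<nu>'"
  shows "(\<integral>\<nu>. of_bool (R \<nu>) * real (gen (Suc n) \<nu>) \<partial>P) = a * (\<integral>\<nu>. of_bool (R \<nu>) * real (gen n \<nu>) \<partial>P)"
proof -
  have int: "integrable P (\<lambda>\<nu>. of_bool (R \<nu>) * real (gen k \<nu>))" for k
    by (rule Bochner_Integration.integrable_bound[OF integrable_gen[of k]]) auto
  have eq: "ennreal (\<integral>\<nu>. of_bool (R \<nu>) * real (gen k \<nu>) \<partial>P) =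
      (\<integral>\<^sup>+\<nu>. of_bool (R \<nu>) * ennreal (real (gen k \<nu>)) \<partial>P)" for k
    by (subst nn_integral_eq_integral[OF int, symmetric]) (auto simp: ennreal_mult'' intro!: nn_integral_cong)
  have nonneg: "0 \<le> (\<integral>\<nu>. of_bool (R \<nu>) * real (gen k \<nu>) \<partial>P)" for k
    by (rule integral_nonneg_AE) auto
  have "ennreal (\<integral>\<nu>. of_bool (R \<nu>) * real (gen (Suc n) \<nu>) \<partial>P) =
      ennreal (a * (\<integral>\<nu>. of_bool (R \<nu>) * real (gen n \<nu>) \<partial>P))"
    using a_gt_1 by (simp add: ennreal_mult'[OF nonneg] ennreal_mult[OF _ nonneg] eq nn_integral_gen_Suc[OF assms])
  then show ?thesis
    using a_gt_1 nonneg by (subst (asm) ennreal_inj) auto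
qed

lemma AE_tendsto_W: "AE \<nu> in P. (\<lambda>n. real (gen n \<nu>) / a ^ n) \<longlonglongrightarrow> W \<nu>"
proof -
  have "AE \<nu> in P. convergent (\<lambda>n. real (gen n \<nu>) / a ^ n)"
  proof (rule P.nonneg_supermartingale_convergent)
    fix n R assume R: "Measurable.pred P R"
      "\<And>\<nu> \<nu>'. (\<And>k. k \<le> n \<Longrightarrow> real (gen k \<nu>) / a ^ k = real (gen k \<nu>') / a ^ k) \<Longrightarrow> R \<nu> = R \<nu>'"
    then have "(\<integral>\<nu>. of_bool (R \<nu>) * real (gen (Suc n) \<nu>) \<partial>P) = a * (\<integral>\<nu>. of_bool (R \<nu>) * real (gen n \<nu>) \<partial>P)"
      by (intro integral_gen_Suc) auto
    then show "(\<integral>\<nu>. of_bool (R \<nu>) * (real (gen (Suc n) \<nu>) / a ^ Suc n) \<partial>P)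
        \<le> (\<integral>\<nu>. of_bool (R \<nu>) * (real (gen n \<nu>) / a ^ n) \<partial>P)"
      using a_gt_1 by simp
  qed (use integrable_gen a_gt_1 in \<open>auto intro!: divide_nonneg_pos\<close>)
  then show ?thesis
    by (simp add: limit_of_def convergent_LIMSEQ_iff)
qed

lemma AE_W_nonneg: "AE \<nu> in P. 0 \<le> W \<nu>"
  using AE_tendsto_W
  by eventually_elim (rule LIMSEQ_le_const, use a_gt_1 in auto)

text \<open>\<open>gen_Suc\<close> divided by \<open>a ^ Suc n\<close>; for fixed \<nu> the sum is
  finite, so limits pass through termwise.\<close>

lemma AE_W_branching: "AE \<nu> in P. W \<nu> = (\<Sum>i<\<nu> []. W (subtree i \<nu>)) / a"
proof -
  have "AE \<nu> in P. \<forall>i. (\<lambda>n. real (gen n (subtree i \<nu>)) / a ^ n) \<longlonglongrightarrow> W (subtree i \<nu>)"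
    using AE_subtree[OF AE_tendsto_W] by (simp add: AE_all_countable)
  with AE_tendsto_W show ?thesis
  proof eventually_elim
    case (elim \<nu>)
    have "(\<lambda>n. (\<Sum>i<\<nu> []. real (gen n (subtree i \<nu>)) / a ^ n) / a) \<longlonglongrightarrow> (\<Sum>i<\<nu> []. W (subtree i \<nu>)) / a"
      using elim(2) by (intro tendsto_divide tendsto_sum tendsto_const) (use a_gt_1 in auto)
    also have "(\<lambda>n. (\<Sum>i<\<nu> []. real (gen n (subtree i \<nu>)) / a ^ n) / a) = (\<lambda>n. real (gen (Suc n) \<nu>) / a ^ Suc n)"
      by (simp add: gen_Suc sum_divide_distrib mult.commute)
    finally show ?case
      using LIMSEQ_Suc[OF elim(1)] LIMSEQ_unique by blast
  qed
qed

text \<open>Fatou. The inequality suffices for its purpose, to see that W \<le> 2 has positive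
  probability.\<close>

lemma nn_integral_W_le_1: "(\<integral>\<^sup>+\<nu>. W \<nu> \<partial>P) \<le> 1"
proof -
  have X: "(\<integral>\<^sup>+\<nu>. real (gen n \<nu>) / a ^ n \<partial>P) = 1" for n
  proof -
    have "(\<integral>\<^sup>+\<nu>. real (gen n \<nu>) / a ^ n \<partial>P) = (\<integral>\<^sup>+\<nu>. ennreal (1 / a ^ n) * real (gen n \<nu>) \<partial>P)"
      using a_gt_1 by (intro nn_integral_cong) (simp flip: ennreal_mult')
    also have "\<dots> = ennreal (1 / a ^ n) * ennreal (a ^ n)"
      by (simp add: nn_integral_cmult nn_integral_gen)
    also have "\<dots> = 1"
      using a_gt_1 by (simp flip: ennreal_mult')
    finally show ?thesis .
  qed
  have "(\<integral>\<^sup>+\<nu>. W \<nu> \<partial>P) = (\<integral>\<^sup>+\<nu>. liminf (\<lambda>n. ennreal (real (gen n \<nu>) / a ^ n)) \<partial>P)"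
    using AE_tendsto_W
    by (intro nn_integral_cong_AE, eventually_elim)
      (auto intro!: lim_imp_Liminf[symmetric] tendsto_ennrealI)
  also have "\<dots> \<le> liminf (\<lambda>n. \<integral>\<^sup>+\<nu>. real (gen n \<nu>) / a ^ n \<partial>P)"
    by (rule nn_integral_liminf) auto
  finally show ?thesis
    by (simp add: X Liminf_const)
qed

end

subsection \<open>Positivity of the martingale limit\<close>

text \<open>Bounds a truncated term by the increment of ln(1 + x) over one step of the geometric
  scale, so that sums along the scale telescope.\<close>

lemma min_le_ln_diff:
  fixes a x :: real
  assumes "1 < a" "0 \<le> x"
  shows "(a - 1) / (a + 1) * min 1 x \<le> ln (1 + a * x) - ln (1 + x)"
proof -
  \<comment> \<open>Since x / (1 + x) is at least half of min 1 x, the quotient (1 + a x) / (1 + x)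
    is at least 1 + z. Then ln(1 + z) \<ge> z / (1 + z), and z \<le> (a - 1) / 2 produces the
    denominator a + 1.\<close>
  define z where "z = (a - 1) * min 1 x / 2"
  have z: "0 \<le> z" "z \<le> (a - 1) / 2"
    using assms by (auto simp: z_def mult_left_le)
  have "min 1 x / 2 \<le> x / (1 + x)"
    using assms(2) by (auto simp: min_def field_simps mult_left_le)
  then have "(a - 1) * (min 1 x / 2) \<le> (a - 1) * (x / (1 + x))"
    using assms(1) by (intro mult_left_mono) auto
  also have "1 + (a - 1) * (x / (1 + x)) = (1 + a * x) / (1 + x)"
    using assms(2) by (simp add: field_simps)
  then have "(a - 1) * (x / (1 + x)) = (1 + a * x) / (1 + x) - 1"
    by simp
  finally have "(a - 1) * (min 1 x / 2) \<le> (1 + a * x) / (1 + x) - 1" .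
  moreover have "z = (a - 1) * (min 1 x / 2)"
    by (simp add: z_def)
  ultimately have z_le: "1 + z \<le> (1 + a * x) / (1 + x)"
    by linarith
  have "(a - 1) / (a + 1) * min 1 x = z / (1 + (a - 1) / 2)"
    using assms by (simp add: z_def field_simps)
  also have "\<dots> \<le> z / (1 + z)"
    using z assms(1) by (intro divide_left_mono mult_pos_pos add_pos_nonneg) auto
  also have "\<dots> \<le> ln (1 + z)"
    using ln_le_minus_one[of "1 / (1 + z)"] z by (simp add: ln_div field_simps)
  also have "\<dots> \<le> ln ((1 + a * x) / (1 + x))"
    using z z_le by (subst ln_le_cancel_iff) auto
  also have "\<dots> = ln (1 + a * x) - ln (1 + x)"
    using add_pos_nonneg[of 1 "a * x"] add_pos_nonneg[of 1 x] assms by (simp add: ln_div)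
  finally show ?thesis .
qed

lemma sum_min_geometric_le:
  fixes a x :: real
  assumes "1 < a" "0 \<le> x"
  shows "(\<Sum>k<n. min 1 (x / a ^ n * a ^ k)) \<le> (a + 1) / (a - 1) * ln (1 + x)"
proof -
  define y where "y = x / a ^ n"
  have y: "0 \<le> y" "y * a ^ n = x"
    using assms by (auto simp: y_def)
  have "(a - 1) / (a + 1) * (\<Sum>k<m. min 1 (y * a ^ k)) \<le> ln (1 + y * a ^ m) - ln (1 + y)" for m
  proof (induction m)
    case (Suc m)
    then show ?case
      using min_le_ln_diff[of a "y * a ^ m"] assms y(1) by (simp add: distrib_left mult.left_commute)
  qed simp
  from this[of n] have "(a - 1) / (a + 1) * (\<Sum>k<n. min 1 (y * a ^ k)) \<le> ln (1 + x)"
    using y assms(2) by (simp add: order_trans)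
  then show ?thesis
    using assms(1) unfolding y_def[symmetric] by (simp add: field_simps)
qed

text \<open>Truncating at 1 keeps the error at most of order \<open>m * v\<close>, so integrating
  over \<open>m\<close> requires no second moment. Below the truncation, (1 - v)^m \<le> exp(-y)
  \<le> 1 - y + y^2 with y = m v.\<close>

lemma one_minus_power_ge:
  fixes v :: real
  assumes "0 \<le> v" "v \<le> 1"
  shows "v * (real m * (1 - min 1 (real m * v))) \<le> 1 - (1 - v) ^ m"
proof (cases "1 \<le> real m * v")
  case True
  then show ?thesis
    using assms by (simp add: power_le_one)
next
  case False
  define y where "y = real m * v"
  have y: "0 \<le> y" "y < 1"
    using False assms by (auto simp: y_def)
  have "(1 - v) ^ m \<le> exp (- v) ^ m"
    using exp_ge_add_one_self[of "- v"] assms by (intro power_mono) auto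
  also have "\<dots> = exp (- y)"
    by (simp add: y_def exp_of_nat_mult[symmetric])
  also have "\<dots> \<le> 1 / (1 + y)"
    using exp_ge_add_one_self[of y] y by (simp add: exp_minus field_simps)
  also have "\<dots> \<le> 1 - y + y\<^sup>2"
    using y by (simp add: field_simps power2_eq_square)
  finally show ?thesis
    using False by (simp add: y_def field_simps power2_eq_square)
qed

section \<open>Laplace transforms of the generation sizes\<close>

context galton_watson
begin

lemma AE_children:
  assumes "AE n in L. R n"
  shows "AE \<nu> in P. R (\<nu> u)"
  using assms by (subst (asm) distr_children[of u, symmetric]) (rule AE_distrD[OF measurable_component_singleton], auto)

lemma integrable_children_iff:
  "integrable P (\<lambda>\<nu>. f (\<nu> u) :: real) \<longleftrightarrow> integrable L f"
  by (subst (2) distr_children[of u, symmetric]) (simp add: integrable_distr_eq)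

lemma integral_children: "(\<integral>\<nu>. f (\<nu> u) \<partial>P) = (\<integral>n. f n \<partial>L :: real)"
  by (subst (2) distr_children[of u, symmetric]) (simp add: integral_distr)

text \<open>Bounds the gap between the mean \<open>a\<close> and the slope (1 - f(1 - v)) / v, where
  f is the generating function of the offspring law and 0 < v \<le> 1.\<close>

definition \<eta> :: "real \<Rightarrow> real" where
  "\<eta> v = (\<integral>n. real n * min 1 (real n * v) \<partial>L)"

lemma integrable_\<eta>: "0 \<le> v \<Longrightarrow> integrable L (\<lambda>n. real n * min 1 (real n * v))"
  by (rule Bochner_Integration.integrable_bound[OF integrable_L]) (auto simp: mult_left_le)

lemma \<eta>_mono: "0 \<le> v \<Longrightarrow> v \<le> w \<Longrightarrow> \<eta> v \<le> \<eta> w"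
  unfolding \<eta>_def by (intro integral_mono integrable_\<eta> mult_left_mono min.mono) (auto intro: mult_left_mono)

lemma \<eta>_nonneg: "0 \<le> v \<Longrightarrow> 0 \<le> \<eta> v"
  unfolding \<eta>_def by (intro integral_nonneg_AE) auto

definition deficit :: "nat \<Rightarrow> real \<Rightarrow> real" where
  "deficit n s = 1 - (\<integral>\<nu>. exp (- s * real (gen n \<nu>)) \<partial>P)"

lemma integrable_exp_gen: "0 \<le> s \<Longrightarrow> integrable P (\<lambda>\<nu>. exp (- s * real (gen n \<nu>)))"
  by (rule P.integrable_const_bound[where B = 1]) auto

lemma deficit_bounds:
  assumes "0 \<le> s"
  shows "0 \<le> deficit n s" "deficit n s \<le> 1" "deficit n s \<le> s * a ^ n"
proof -
  have "(\<integral>\<nu>. exp (- s * real (gen n \<nu>)) \<partial>P) \<le> (\<integral>\<nu>. 1 \<partial>P)"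
    using assms by (intro integral_mono integrable_exp_gen) auto
  then show "0 \<le> deficit n s"
    by (simp add: deficit_def)
  show "deficit n s \<le> 1"
    by (simp add: deficit_def integral_nonneg_AE)
  have "(\<integral>\<nu>. 1 - s * real (gen n \<nu>) \<partial>P) \<le> (\<integral>\<nu>. exp (- s * real (gen n \<nu>)) \<partial>P)"
    using assms exp_ge_add_one_self[of "- s * real (gen n \<nu>)" for \<nu>]
    by (intro integral_mono integrable_exp_gen) (auto intro!: Bochner_Integration.integrable_diff integrable_mult_right integrable_gen)
  then show "deficit n s \<le> s * a ^ n"
    by (simp add: deficit_def integrable_gen integral_gen)
qed

text \<open>The Laplace transform of the next generation is the offspring generating function
  applied to the current one, by branching at the root.\<close>

lemma deficit_Suc:
  assumes "0 \<le> s"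
  shows "deficit (Suc n) s = 1 - (\<integral>m. (1 - deficit n s) ^ m \<partial>L)"
proof -
  let ?\<psi> = "1 - deficit n s"
  have bounds: "0 \<le> ?\<psi>" "?\<psi> \<le> 1"
    using deficit_bounds[OF assms, of n] by auto
  have nn: "(\<integral>\<^sup>+\<nu>. exp (- s * real (gen n \<nu>)) \<partial>P) = ennreal ?\<psi>" 
    using nn_integral_eq_integral[OF integrable_exp_gen[OF assms, of n]] by (simp add: deficit_def)
  have "ennreal (\<integral>\<nu>. exp (- s * real (gen (Suc n) \<nu>)) \<partial>P) = (\<integral>\<^sup>+\<nu>. exp (- s * real (gen (Suc n) \<nu>)) \<partial>P)"
    using nn_integral_eq_integral[OF integrable_exp_gen[OF assms, of "Suc n"]] by simp
  also have "\<dots> = (\<integral>\<^sup>+\<nu>. (\<Prod>i<\<nu> []. ennreal (exp (- s * real (gen n (subtree i \<nu>))))) \<partial>P)"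
    by (simp add: gen_Suc prod_ennreal exp_sum[symmetric] sum_distrib_left sum_negf)
  also have "\<dots> = (\<integral>\<^sup>+\<nu>. ennreal (?\<psi> ^ \<nu> []) \<partial>P)"
    using bounds by (subst nn_integral_branching, measurable) (simp only: nn ennreal_power)
  also have "\<dots> = ennreal (\<integral>\<nu>. ?\<psi> ^ \<nu> [] \<partial>P)"
    using bounds by (intro nn_integral_eq_integral P.integrable_const_bound[where B = 1]) (auto simp: power_le_one)
  also have "(\<integral>\<nu>. ?\<psi> ^ \<nu> [] \<partial>P) = (\<integral>m. ?\<psi> ^ m \<partial>L)"
    by (rule integral_children)
  finally show ?thesis
    using bounds by (subst (asm) ennreal_inj) (auto simp: deficit_def[of "Suc n"] integral_nonneg_AE)
qed

text \<open>
  The factor \<open>\<eta>\<close> is evaluated at the upper bound \<open>s * a ^ n\<close> for the deficit. Along \<open>s = t / a ^ n\<close> these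
  factors then sum up to at most a multiple of \<open>E (N ln (1 + t N))\<close>, which is where the
  logarithmic moment enters.
\<close>

lemma deficit_Suc_ge:
  assumes s: "0 \<le> s"
  shows "deficit n s * (a - \<eta> (s * a ^ n)) \<le> deficit (Suc n) s"
proof -
  let ?v = "deficit n s"
  note v = deficit_bounds[OF s, of n]
  have int: "integrable L (\<lambda>m. (1 - ?v) ^ m)"
    using v by (intro integrable_const_bound[where B = 1]) (auto simp: power_le_one)
  have "?v * (a - \<eta> (s * a ^ n)) \<le> ?v * (a - \<eta> ?v)"
    using v by (intro mult_left_mono diff_left_mono \<eta>_mono) auto
  also have "\<dots> = (\<integral>m. ?v * (real m - real m * min 1 (real m * ?v)) \<partial>L)"
    using v integrable_L integrable_\<eta> by (simp add: a_eq \<eta>_def)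
  also have "\<dots> \<le> (\<integral>m. 1 - (1 - ?v) ^ m \<partial>L)"
    using v integrable_L integrable_\<eta> int one_minus_power_ge[of ?v]
    by (intro integral_mono) (auto simp: right_diff_distrib)
  also have "\<dots> = deficit (Suc n) s"
    using int by (simp add: deficit_Suc[OF s])
  finally show ?thesis .
qed

text \<open>Iterates \<open>deficit_Suc_ge\<close> from 1 - exp(-s) at generation 0, with the
  product of factors 1 - e bounded below by 1 minus their sum.\<close>

lemma deficit_ge:
  assumes s: "0 \<le> s"
  shows "(1 - exp (- s)) * a ^ n * (1 - (\<Sum>k<n. \<eta> (s * a ^ k)) / a) \<le> deficit n s"
proof (induction n)
  case 0
  then show ?case
    by (simp add: deficit_def)
next
  case (Suc n)
  let ?A = "(1 - exp (- s)) * a ^ n" and ?S = "(\<Sum>k<n. \<eta> (s * a ^ k)) / a" and ?e = "\<eta> (s * a ^ n) / a"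
  have A: "0 \<le> ?A"
    using s a_gt_1 by simp
  have S: "0 \<le> ?S" "0 \<le> ?e"
    using s a_gt_1 by (auto intro!: divide_nonneg_pos sum_nonneg \<eta>_nonneg)
  have *: "(1 - exp (- s)) * a ^ Suc n * (1 - (\<Sum>k<Suc n. \<eta> (s * a ^ k)) / a) = ?A * a * (1 - ?S - ?e)"
    by (simp add: add_divide_distrib mult_ac)
  show ?case
  \<comment> \<open>Multiplying the induction hypothesis by \<open>a - \<eta> (s * a ^ n)\<close>
    needs this factor to be nonnegative; otherwise the claimed lower bound is itself
    nonpositive.\<close>
  proof (cases "?e \<le> 1")
    case True
    have "?A * a * (1 - ?S - ?e) \<le> ?A * a * ((1 - ?S) * (1 - ?e))"
    proof (rule mult_left_mono)
      have "1 - x - y \<le> (1 - x) * (1 - y)" if "0 \<le> x" "0 \<le> y" for x y :: real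
        using mult_nonneg_nonneg[OF that] by (simp add: algebra_simps)
      then show "1 - ?S - ?e \<le> (1 - ?S) * (1 - ?e)"
        using S by blast
    qed (use A a_gt_1 in auto)
    also have "\<dots> = (?A * (1 - ?S)) * (a - \<eta> (s * a ^ n))"
      using a_gt_1 by (simp add: field_simps)
    also have "\<dots> \<le> deficit n s * (a - \<eta> (s * a ^ n))"
      using True a_gt_1 by (intro mult_right_mono Suc) (simp add: field_simps)
    also have "\<dots> \<le> deficit (Suc n) s"
      by (rule deficit_Suc_ge[OF s])
    finally show ?thesis
      unfolding * .
  next
    case False
    then have "?A * a * (1 - ?S - ?e) \<le> 0"
      using A S(1) a_gt_1 by (intro mult_nonneg_nonpos) (simp, linarith)
    then show ?thesis
      unfolding * using deficit_bounds(1)[OF s, of "Suc n"] by simp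
  qed
qed

lemma integrable_n_ln_Suc: "integrable L (\<lambda>n. real n * ln (1 + real n))"
proof (rule Bochner_Integration.integrable_bound)
  show "integrable L (\<lambda>n. real n * ln 2 + real n * ln (real n))"
    using integrable_L integrable_n_ln_n by auto
  have "real n * ln (1 + real n) \<le> real n * ln 2 + real n * ln (real n)" for n
  proof (cases "n = 0")
    case False
    then have "ln (1 + real n) \<le> ln (2 * real n)"
      by (subst ln_le_cancel_iff) auto
    with False show ?thesis
      by (simp add: ln_mult distrib_left[symmetric])
  qed simp
  then show "AE n in L. norm (real n * ln (1 + real n)) \<le> norm (real n * ln 2 + real n * ln (real n))"
    by (auto intro!: AE_I2 simp: abs_of_nonneg order_trans[OF _ abs_ge_self])
qed simp

text \<open>Dominated convergence along t = 1 / (k + 1); the majorant n ln(1 + n) is integrable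
  because of the N log N moment.\<close>

lemma ex_small_logarithmic_moment:
  assumes "0 < e"
  obtains t where "0 < t" "t \<le> 1" "(\<integral>n. real n * ln (1 + real n * t) \<partial>L) \<le> e"
proof -
  have "(\<lambda>k. \<integral>n. real n * ln (1 + real n * (1 / real (Suc k))) \<partial>L) \<longlonglongrightarrow> (\<integral>n. 0 \<partial>L)"
  proof (rule integral_dominated_convergence)
    show "integrable L (\<lambda>n. real n * ln (1 + real n))"
      by (rule integrable_n_ln_Suc)
    have "(\<lambda>k. real n * ln (1 + real n * (1 / real (Suc k)))) \<longlonglongrightarrow> real n * ln (1 + real n * 0)" for n
      using LIMSEQ_inverse_real_of_nat
      by (intro tendsto_intros) (auto simp: inverse_eq_divide)
    then show "AE n in L. (\<lambda>k. real n * ln (1 + real n * (1 / real (Suc k)))) \<longlonglongrightarrow> 0"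
      by simp
    have "ln (1 + real n * (1 / real (Suc k))) \<le> ln (1 + real n)" for n k
      by (subst ln_le_cancel_iff) (auto simp: field_simps intro: add_pos_nonneg)
    then show "AE n in L. norm (real n * ln (1 + real n * (1 / real (Suc k)))) \<le> real n * ln (1 + real n)" for k
      by (auto intro!: AE_I2 mult_left_mono simp: abs_mult)
  qed auto
  then have "\<forall>\<^sub>F k in sequentially. (\<integral>n. real n * ln (1 + real n * (1 / real (Suc k))) \<partial>L) < e"
    using assms by (intro order_tendstoD) auto
  then obtain k where "(\<integral>n. real n * ln (1 + real n * (1 / real (Suc k))) \<partial>L) < e"
    using eventually_happens'[OF sequentially_bot] by blast
  then show ?thesis
    by (intro that[of "1 / real (Suc k)"]) auto
qed

lemma ex_laplace_W_less_1: "\<exists>t>0. (\<integral>\<nu>. exp (- t * W \<nu>) \<partial>P) < 1"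
proof -
  define C where "C = (a + 1) / (a - 1)"
  have C: "0 < C"
    using a_gt_1 by (simp add: C_def)
  \<comment> \<open>\<open>C\<close> is the constant of \<open>sum_min_geometric_le\<close>. The
    bound \<open>a / 2 / C\<close> makes the total relative loss at most 1/2, for every
    \<open>n\<close>.\<close>
  obtain t where t: "0 < t" "t \<le> 1" "(\<integral>n. real n * ln (1 + real n * t) \<partial>L) \<le> a / 2 / C"
    using ex_small_logarithmic_moment[of "a / 2 / C"] a_gt_1 C by auto
  \<comment> \<open>The 1/4 is a product of two halves: 1 - exp(-s) \<ge> s / 2 for s \<le> 1, and
    at most half is lost along the generations; moreover \<open>?s * a ^ n = t\<close>.\<close>
  have "(\<integral>\<nu>. exp (- t * (real (gen n \<nu>) / a ^ n)) \<partial>P) \<le> 1 - t / 4" for n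
  proof -
    let ?s = "t / a ^ n"
    have s: "0 < ?s" "?s \<le> 1"
      using t a_gt_1 by (auto simp: field_simps one_le_power intro: order_trans[of t 1])
    have int: "integrable L (\<lambda>m. real m * ln (1 + real m * t))"
    proof (rule Bochner_Integration.integrable_bound[OF integrable_n_ln_Suc])
      have "ln (1 + real m * t) \<le> ln (1 + real m)" for m
        using t by (subst ln_le_cancel_iff) (auto simp: mult_left_le intro: add_pos_nonneg)
      then show "AE m in L. norm (real m * ln (1 + real m * t)) \<le> norm (real m * ln (1 + real m))"
        using t by (auto intro!: AE_I2 mult_left_mono simp: abs_mult)
    qed auto
    have "(\<Sum>k<n. \<eta> (?s * a ^ k)) = (\<integral>m. (\<Sum>k<n. real m * min 1 (real m * (?s * a ^ k))) \<partial>L)"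
      unfolding \<eta>_def using s a_gt_1
      by (intro Bochner_Integration.integral_sum[symmetric] integrable_\<eta> mult_nonneg_nonneg) auto
    also have "\<dots> = (\<integral>m. real m * (\<Sum>k<n. min 1 (real m * t / a ^ n * a ^ k)) \<partial>L)"
      by (simp add: sum_distrib_left mult_ac)
    also have "\<dots> \<le> (\<integral>m. real m * (C * ln (1 + real m * t)) \<partial>L)"
    proof (rule integral_mono)
      show "integrable L (\<lambda>m. real m * (\<Sum>k<n. min 1 (real m * t / a ^ n * a ^ k)))"
      proof -
        have "integrable L (\<lambda>m. real m * min 1 (real m * t / a ^ n * a ^ k))" for k
          using integrable_\<eta>[of "?s * a ^ k"] t(1) a_gt_1 by (simp add: mult_ac)
        then show ?thesis
          by (simp add: sum_distrib_left)
      qed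
      show "integrable L (\<lambda>m. real m * (C * ln (1 + real m * t)))"
        using int by (simp add: mult.left_commute)
      show "real m * (\<Sum>k<n. min 1 (real m * t / a ^ n * a ^ k)) \<le> real m * (C * ln (1 + real m * t))" for m
        unfolding C_def using t(1) by (intro mult_left_mono sum_min_geometric_le a_gt_1) auto
    qed
    also have "\<dots> \<le> a / 2"
      using t(3) C by (simp add: mult.left_commute field_simps)
    finally have "(\<Sum>k<n. \<eta> (?s * a ^ k)) / a \<le> 1 / 2"
      using a_gt_1 by (simp add: field_simps)
    moreover have "?s / 2 \<le> 1 - exp (- ?s)"
    proof -
      have "exp (- ?s) \<le> 1 / (1 + ?s)"
        using exp_ge_add_one_self[of ?s] s(1) unfolding exp_minus inverse_eq_divide
        by (intro divide_left_mono) (auto intro: mult_pos_pos)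
      also have "\<dots> \<le> 1 - y / 2" if "y = ?s" for y
        using s unfolding that[symmetric] by (simp add: field_simps mult_left_le)
      finally show ?thesis by auto
    qed
    ultimately have "?s / 2 * a ^ n * (1 / 2) \<le> (1 - exp (- ?s)) * a ^ n * (1 - (\<Sum>k<n. \<eta> (?s * a ^ k)) / a)"
      using s a_gt_1 by (intro mult_mono mult_nonneg_nonneg) auto
    also have "\<dots> \<le> deficit n ?s"
      using s by (intro deficit_ge) auto
    finally show ?thesis
      using a_gt_1 by (simp add: deficit_def)
  qed
  moreover have "(\<lambda>n. \<integral>\<nu>. exp (- t * (real (gen n \<nu>) / a ^ n)) \<partial>P) \<longlonglongrightarrow> (\<integral>\<nu>. exp (- t * W \<nu>) \<partial>P)"
  proof (rule integral_dominated_convergence)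
    show "AE \<nu> in P. (\<lambda>n. exp (- t * (real (gen n \<nu>) / a ^ n))) \<longlonglongrightarrow> exp (- t * W \<nu>)"
      using AE_tendsto_W by eventually_elim (intro tendsto_intros)
    show "AE \<nu> in P. norm (exp (- t * (real (gen n \<nu>) / a ^ n))) \<le> (1 :: real)" for n
      using t a_gt_1 by auto
  qed auto
  ultimately have "(\<integral>\<nu>. exp (- t * W \<nu>) \<partial>P) \<le> 1 - t / 4"
    by (intro LIMSEQ_le_const2) auto
  then show ?thesis
    using t(1) by (intro exI[of _ t]) auto
qed

lemma AE_W_pos: "AE \<nu> in P. 0 < W \<nu>"
proof -
  let ?Z = "{\<nu>. W \<nu> \<le> 0}"
  define q where "q = P.prob ?Z"
  have [measurable]: "?Z \<in> sets P"
    by (rule sets_P_Collect) measurable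
  have q_ne_1: "q \<noteq> 1"
  proof
    assume "q = 1"
    then have "AE \<nu> in P. W \<nu> \<le> 0"
      using P.prob_Collect_eq_1[of "\<lambda>\<nu>. W \<nu> \<le> 0"] by (simp add: q_def)
    then have "AE \<nu> in P. W \<nu> = 0"
      using AE_W_nonneg by eventually_elim auto
    then have "(\<integral>\<nu>. exp (- t * W \<nu>) \<partial>P) = (\<integral>\<nu>. 1 \<partial>P)" for t
      by (intro integral_cong_AE) auto
    then show False
      using ex_laplace_W_less_1 by auto
  qed
  have q_bounds: "0 \<le> q" "q \<le> 1"
    by (auto simp: q_def)
  have ge1: "AE n in L. 1 \<le> n"
    using AE_ge_\<mu> by eventually_elim (use \<mu>_ge_1 in auto)
  have int: "integrable L (\<lambda>n. q ^ n)"
    using q_bounds by (intro integrable_const_bound[where B = 1]) (auto simp: power_le_one)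
  have "ennreal q = (\<integral>\<^sup>+\<nu>. indicator ?Z \<nu> \<partial>P)"
    by (simp add: q_def P.emeasure_eq_measure)
  \<comment> \<open>A vanishing sum of nonnegative limits has only vanishing terms, so W = 0 forces
    W = 0 in every subtree of the root.\<close>
  also have "\<dots> \<le> (\<integral>\<^sup>+\<nu>. (\<Prod>i<\<nu> []. indicator ?Z (subtree i \<nu>)) \<partial>P)"
  proof (rule nn_integral_mono_AE)
    have "AE \<nu> in P. \<forall>i. 0 \<le> W (subtree i \<nu>)"
      using AE_subtree[OF AE_W_nonneg] by (simp add: AE_all_countable)
    with AE_W_branching AE_W_nonneg
    show "AE \<nu> in P. indicator ?Z \<nu> \<le> (\<Prod>i<\<nu> []. indicator ?Z (subtree i \<nu>) :: ennreal)"
    proof eventually_elim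
      case (elim \<nu>)
      show ?case
      proof (cases "W \<nu> \<le> 0")
        case True
        then have "(\<Sum>i<\<nu> []. W (subtree i \<nu>)) = 0"
          using elim(1,2) a_gt_1 by simp
        then have "\<forall>i<\<nu> []. W (subtree i \<nu>) = 0"
          using elim(3) by (subst (asm) sum_nonneg_eq_0_iff) auto
        then have "(\<Prod>i<\<nu> []. indicator ?Z (subtree i \<nu>)) = (1 :: ennreal)"
          by (intro prod.neutral) auto
        then show ?thesis
          by (simp add: indicator_def)
      qed simp
    qed
  qed
  also have "\<dots> = (\<integral>\<^sup>+\<nu>. ennreal (q ^ \<nu> []) \<partial>P)"
    using q_bounds by (subst nn_integral_branching) (simp_all add: P.emeasure_eq_measure q_def ennreal_power)
  also have "\<dots> = ennreal (\<integral>\<nu>. q ^ \<nu> [] \<partial>P)"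
    using int q_bounds by (intro nn_integral_eq_integral) (auto simp: integrable_children_iff)
  finally have q_le: "q \<le> (\<integral>n. q ^ n \<partial>L)"
    using q_bounds by (simp add: integral_children integral_nonneg_AE)
  \<comment> \<open>As N \<ge> 1, q - q^N is nonnegative, while its mean is at most 0 by
    \<open>q_le\<close>. So it vanishes almost surely, and 0 < q < 1 would force N = 1,
    contradicting a > 1.\<close>
  have nonneg: "AE n in L. 0 \<le> q - q ^ n"
    using ge1 by eventually_elim (use q_bounds in \<open>auto simp: power_decreasing[of 1 _ q, simplified]\<close>)
  then have "(\<integral>n. q - q ^ n \<partial>L) = 0"
    using q_le int integral_nonneg_AE[OF nonneg] by (simp add:)
  then have eq: "AE n in L. q = q ^ n"
    using integral_nonneg_eq_0_iff_AE[OF _ nonneg] int by simp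
  have "q = 0"
  proof (rule ccontr)
    assume "q \<noteq> 0"
    then have q: "0 < q" "q < 1"
      using q_bounds q_ne_1 by auto
    from eq ge1 have "AE n in L. real n = 1"
    proof eventually_elim
      case (elim n)
      then show ?case
        using power_strict_decreasing[of 1 n q] q by (cases "n = 1") auto
    qed
    then have "a = (\<integral>n. 1 \<partial>L)"
      unfolding a_eq by (intro integral_cong_AE) auto
    then show False
      using a_gt_1 by (simp add:)
  qed
  then have "AE \<nu> in P. \<not> W \<nu> \<le> 0"
    using P.prob_eq_0[of ?Z] by (simp add: q_def)
  then show ?thesis
    by (simp add: not_le)
qed

lemma prob_W_less_tendsto_0: "((\<lambda>x. P.prob {\<nu>. W \<nu> < x}) \<longlongrightarrow> 0) (at_right 0)"
proof -
  have m [measurable]: "{\<nu>. W \<nu> < x} \<in> sets P" for x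
    by (rule sets_P_Collect) measurable
  let ?A = "\<lambda>n. {\<nu>. W \<nu> < 1 / real (Suc n)}"
  have "(\<lambda>n. P.prob (?A n)) \<longlonglongrightarrow> P.prob (\<Inter>n. ?A n)"
  proof (rule P.finite_Lim_measure_decseq)
    show "decseq ?A"
      unfolding decseq_def
    proof (intro allI impI subsetI CollectI)
      fix m n \<nu> assume "m \<le> n" and "\<nu> \<in> ?A n"
      then have "W \<nu> < 1 / real (Suc n)" "1 / real (Suc n) \<le> 1 / real (Suc m)"
        by (auto intro!: divide_left_mono)
      then show "W \<nu> < 1 / real (Suc m)"
        by linarith
    qed
  qed auto
  also have "P.prob (\<Inter>n. ?A n) = 0"
  proof -
    have "AE \<nu> in P. \<nu> \<notin> (\<Inter>n. ?A n)"
      using AE_W_pos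
    proof eventually_elim
      case (elim \<nu>)
      then obtain n where "inverse (real (Suc n)) < W \<nu>"
        using reals_Archimedean by blast
      then show ?case
        by (auto simp: inverse_eq_divide not_less intro!: exI[of _ n])
    qed
    then show ?thesis
      by (subst P.prob_eq_0) auto
  qed
  finally have lim: "(\<lambda>n. P.prob (?A n)) \<longlonglongrightarrow> 0" .
  show ?thesis
  proof (rule tendstoI)
    fix e :: real assume "0 < e"
    with lim have "\<forall>\<^sub>F n in sequentially. P.prob (?A n) < e"
      by (intro order_tendstoD) auto
    then obtain n where n: "P.prob (?A n) < e"
      using eventually_happens'[OF sequentially_bot] by blast
    have "P.prob {\<nu>. W \<nu> < x} < e" if "x < 1 / real (Suc n)" for x
      using that by (intro le_less_trans[OF P.finite_measure_mono n]) auto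
    then show "\<forall>\<^sub>F x in at_right 0. dist (P.prob {\<nu>. W \<nu> < x}) 0 < e"
      by (auto simp: eventually_at_right_field intro!: exI[of _ "1 / real (Suc n)"])
  qed
qed

end

subsection \<open>Conditioning on a small martingale limit\<close>

lemma generation_size_trunc: "generation_size t k = card {u \<in> trunc k t. length u = k}"
  unfolding generation_size_def trunc_def by (rule arg_cong[where f = card]) auto

lemma generation_size_regular_tree: "generation_size (regular_tree m) k = m ^ k"
proof (induction k)
  case 0
  show ?case
    unfolding regular_tree_def by simp
next
  case (Suc k)
  then show ?case
    by (simp add: regular_tree_def gen_Suc subtree_def)
qed

lemma measurable_trunc [measurable]: "Measurable.pred borel (\<lambda>t. trunc k t = A)"
  using open_trunc_eq[of "\<lambda>B. B = A" k] by (simp add: pred_def)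

lemma trunc_eq_if_close:
  fixes f :: "rooted_tree \<Rightarrow> real"
  assumes "continuous_on UNIV f" "0 < e"
  obtains n where "\<And>s. trunc n s = trunc n t \<Longrightarrow> \<bar>f s - f t\<bar> < e"
proof -
  have "open (f -` ball (f t) e)"
    using assms(1) by (intro open_vimage) auto
  moreover have "t \<in> f -` ball (f t) e"
    using assms(2) by simp
  ultimately obtain n where "{s. trunc n s = trunc n t} \<subseteq> f -` ball (f t) e"
    using open_rooted_tree_trunc by blast
  then show ?thesis
    by (intro that[of n]) (auto simp: dist_real_def subset_iff abs_minus_commute)
qed

section \<open>Product formulas for events at the root and in one subtree\<close>

context offspring
begin

lemma prob_mult_resample:
  assumes [measurable]: "Measurable.pred P A" "Measurable.pred P B"
    and "\<And>\<nu> \<xi>. A (override_on \<nu> \<xi> K) = A \<nu>" "\<And>\<nu> \<xi>. B (override_on \<nu> \<xi> K) = B \<xi>"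
  shows "P.prob {\<nu>. A \<nu> \<and> B \<nu>} = P.prob {\<nu>. A \<nu>} * P.prob {\<nu>. B \<nu>}"
proof -
  have prob: "(\<integral>\<^sup>+\<nu>. indicator {\<nu>. R \<nu>} \<nu> \<partial>P) = ennreal (P.prob {\<nu>. R \<nu>})" if "Measurable.pred P R" for R
    using sets_P_Collect[OF that] by (simp add: P.emeasure_eq_measure)
  have "ennreal (P.prob {\<nu>. A \<nu> \<and> B \<nu>}) = (\<integral>\<^sup>+\<nu>. indicator {\<nu>. A \<nu>} \<nu> * indicator {\<nu>. B \<nu>} \<nu> \<partial>P)"
    by (subst prob[symmetric]) (auto intro!: nn_integral_cong simp: indicator_def)
  also have "\<dots> = ennreal (P.prob {\<nu>. A \<nu>}) * ennreal (P.prob {\<nu>. B \<nu>})"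
    using assms(3,4) sets_P_Collect[OF assms(1)] sets_P_Collect[OF assms(2)]
    by (subst nn_integral_mult_resample[OF prob_space_axioms, where B = K])
      (auto simp: indicator_def P.emeasure_eq_measure)
  finally show ?thesis
    by (simp flip: ennreal_mult')
qed

lemma prob_root:
  assumes "Measurable.pred P A" "\<And>\<nu> \<xi>. A (override_on \<nu> \<xi> {[]}) = A \<nu>"
  shows "P.prob {\<nu>. A \<nu> \<and> R (\<nu> [])} = P.prob {\<nu>. A \<nu>} * P.prob {\<nu>. R (\<nu> [])}"
  using assms by (intro prob_mult_resample[where K = "{[]}"]) auto

lemma prob_subtree:
  assumes [measurable]: "Measurable.pred P A" "Measurable.pred P R"
    and "\<And>\<nu> \<xi>. A (override_on \<nu> \<xi> (range (Cons i))) = A \<nu>"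
  shows "P.prob {\<nu>. A \<nu> \<and> R (subtree i \<nu>)} = P.prob {\<nu>. A \<nu>} * P.prob {\<nu>. R \<nu>}"
proof -
  have "P.prob {\<nu>. R (subtree i \<nu>)} = measure (distr P P (subtree i)) {\<nu>. R \<nu>}"
    using assms(2) by (subst measure_distr) (auto simp: pred_def vimage_def)
  then show ?thesis
    using assms by (subst prob_mult_resample[where K = "range (Cons i)"]) (auto simp: distr_subtree)
qed

end

context galton_watson
begin

lemma AE_subtrees_W_pos: "AE \<nu> in P. \<forall>i. 0 < W (subtree i \<nu>)"
  using AE_subtree[OF AE_W_pos] by (simp add: AE_all_countable)

lemma prob_root_\<mu>: "P.prob {\<nu>. \<nu> [] = \<mu>} = prob {\<mu>}"
proof -
  have "prob {\<mu>} = measure (distr P L (\<lambda>\<nu>. \<nu> [])) {\<mu>}"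
    by (simp add: distr_children)
  also have "\<dots> = P.prob {\<nu>. \<nu> [] = \<mu>}"
    by (subst measure_distr) (auto simp: vimage_def sets_L)
  finally show ?thesis ..
qed

lemma prob_W_le_pos:
  assumes "0 < P.prob {\<nu>. W \<nu> \<le> c}"
  shows "0 < P.prob {\<nu>. W \<nu> \<le> c * (\<mu> / a)}"
proof -
  \<comment> \<open>The root condition stays in every \<open>?A m\<close>: the base case is P(N =
    \<mu>), and each further subtree contributes one independent factor.\<close>
  let ?A = "\<lambda>m. {\<nu>. (\<forall>i<m. W (subtree i \<nu>) \<le> c) \<and> \<nu> [] = \<mu>}"
  have "0 < P.prob (?A m)" for m
  proof (induction m)
    case 0
    then show ?case
      by (simp add: prob_root_\<mu> prob_\<mu>)
  next
    case (Suc m)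
    have "?A (Suc m) = {\<nu>. ((\<forall>i<m. W (subtree i \<nu>) \<le> c) \<and> \<nu> [] = \<mu>) \<and> W (subtree m \<nu>) \<le> c}"
      by (auto simp: less_Suc_eq)
    also have "P.prob \<dots> = P.prob (?A m) * P.prob {\<nu>. W \<nu> \<le> c}"
      by (rule prob_subtree) auto
    finally show ?case
      using Suc assms by simp
  qed
  also have "P.prob (?A \<mu>) \<le> P.prob {\<nu>. W \<nu> \<le> c * (\<mu> / a)}"
  proof (rule P.finite_measure_mono_AE)
    show "AE \<nu> in P. \<nu> \<in> ?A \<mu> \<longrightarrow> \<nu> \<in> {\<nu>. W \<nu> \<le> c * (\<mu> / a)}"
      using AE_W_branching
    proof eventually_elim
      case (elim \<nu>)
      have "(\<Sum>i<\<mu>. W (subtree i \<nu>)) \<le> (\<Sum>i<\<mu>. c)" if "\<nu> \<in> ?A \<mu>"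
        using that by (intro sum_mono) auto
      with elim show ?case
        using a_gt_1 by (auto simp: field_simps)
    qed
  qed (rule sets_P_Collect, measurable)
  finally show ?thesis .
qed

lemma prob_W_less_pos:
  assumes "0 < x"
  shows "0 < P.prob {\<nu>. W \<nu> < x}"
proof -
  \<comment> \<open>The start 2 exceeds the bound 1 on the mean of W; each further step uses
    \<open>prob_W_le_pos\<close>.\<close>
  have "0 < P.prob {\<nu>. W \<nu> \<le> 2 * (\<mu> / a) ^ n}" for n
  proof (induction n)
    case 0
    show ?case
    proof (rule ccontr)
      assume "\<not> ?thesis"
      then have "P.prob {\<nu>. W \<nu> \<le> 2} = 0"
        by (simp add: zero_less_measure_iff)
      moreover have "{\<nu>. W \<nu> \<le> 2} \<in> sets P"
        by (rule sets_P_Collect) measurable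
      ultimately have "AE \<nu> in P. \<not> W \<nu> \<le> 2"
        using P.prob_eq_0 by auto
      then have "(\<integral>\<^sup>+\<nu>. 2 \<partial>P) \<le> (\<integral>\<^sup>+\<nu>. W \<nu> \<partial>P)"
        by (intro nn_integral_mono_AE, eventually_elim)
          (use ennreal_leI[of 2] in \<open>auto simp: not_le less_imp_le\<close>)
      then have "2 \<le> (\<integral>\<^sup>+\<nu>. W \<nu> \<partial>P)"
        by (simp add: P.emeasure_space_1[simplified])
      then have "2 \<le> (1 :: ennreal)"
        using nn_integral_W_le_1 by (rule order_trans)
      then show False
        by simp
    qed
  next
    case (Suc n)
    then show ?case
      using prob_W_le_pos[of "2 * (\<mu> / a) ^ n"] by (simp add: mult_ac)
  qed
  moreover have "(\<lambda>n. 2 * (\<mu> / a) ^ n) \<longlonglongrightarrow> 2 * 0"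
    using \<mu>_less_a a_gt_1 by (intro tendsto_intros LIMSEQ_realpow_zero) auto
  then have "\<forall>\<^sub>F n in sequentially. 2 * (\<mu> / a) ^ n < x"
    using assms by (intro order_tendstoD) auto
  then obtain n where "2 * (\<mu> / a) ^ n < x"
    using eventually_happens'[OF sequentially_bot] by blast
  then have "P.prob {\<nu>. W \<nu> \<le> 2 * (\<mu> / a) ^ n} \<le> P.prob {\<nu>. W \<nu> < x}"
    by (intro P.finite_measure_mono) (auto intro!: sets_P_Collect)
  ultimately show ?thesis
    using less_le_trans by blast
qed

text \<open>On N = \<mu>, W < x says that the first \<mu> subtree limits sum to less than a x, an
  event that ignores the root. The identity is exact, so it is also used backwards, to bound events
  of the sum by events of W.\<close>

lemma prob_root_sum_less:
  assumes [measurable]: "Measurable.pred P A" and "\<And>\<nu> \<xi>. A (override_on \<nu> \<xi> {[]}) = A \<nu>"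
  shows "P.prob {\<nu>. A \<nu> \<and> \<nu> [] = \<mu> \<and> W \<nu> < x} =
    P.prob {\<nu>. A \<nu> \<and> (\<Sum>i<\<mu>. W (subtree i \<nu>)) < a * x} * prob {\<mu>}"
proof -
  have "P.prob {\<nu>. A \<nu> \<and> \<nu> [] = \<mu> \<and> W \<nu> < x} =
      P.prob {\<nu>. (A \<nu> \<and> (\<Sum>i<\<mu>. W (subtree i \<nu>)) < a * x) \<and> \<nu> [] = \<mu>}"
  proof (rule P.finite_measure_eq_AE)
    show "AE \<nu> in P. \<nu> \<in> {\<nu>. A \<nu> \<and> \<nu> [] = \<mu> \<and> W \<nu> < x} \<longleftrightarrow>
        \<nu> \<in> {\<nu>. (A \<nu> \<and> (\<Sum>i<\<mu>. W (subtree i \<nu>)) < a * x) \<and> \<nu> [] = \<mu>}"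
      using AE_W_branching by eventually_elim (use a_gt_1 in \<open>auto simp: pos_divide_less_eq mult.commute\<close>)
    show "{\<nu>. A \<nu> \<and> \<nu> [] = \<mu> \<and> W \<nu> < x} \<in> sets P"
      by (rule sets_P_Collect) measurable
    show "{\<nu>. (A \<nu> \<and> (\<Sum>i<\<mu>. W (subtree i \<nu>)) < a * x) \<and> \<nu> [] = \<mu>} \<in> sets P"
      by (rule sets_P_Collect) measurable
  qed
  also have "\<dots> = P.prob {\<nu>. A \<nu> \<and> (\<Sum>i<\<mu>. W (subtree i \<nu>)) < a * x} * prob {\<mu>}"
    unfolding prob_root_\<mu>[symmetric] using assms(2) by (intro prob_root) auto
  finally show ?thesis .
qed

text \<open>
  One child more than necessary requires one further independent copy of \<open>W\<close> to be small.
\<close>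

lemma prob_root_ne_\<mu>_le:
  "P.prob {\<nu>. \<nu> [] \<noteq> \<mu> \<and> W \<nu> < x} \<le> P.prob {\<nu>. W \<nu> < a * x} / prob {\<mu>} * P.prob {\<nu>. W \<nu> < x}"
proof -
  let ?S = "\<lambda>\<nu>. \<Sum>i<\<mu>. W (subtree i \<nu>)"
  have "P.prob {\<nu>. \<nu> [] \<noteq> \<mu> \<and> W \<nu> < x} \<le> P.prob {\<nu>. ?S \<nu> < a * x \<and> W (subtree \<mu> \<nu>) < a * x}"
  proof (rule P.finite_measure_mono_AE)
    show "AE \<nu> in P. \<nu> \<in> {\<nu>. \<nu> [] \<noteq> \<mu> \<and> W \<nu> < x} \<longrightarrow> \<nu> \<in> {\<nu>. ?S \<nu> < a * x \<and> W (subtree \<mu> \<nu>) < a * x}"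
      using AE_W_branching AE_subtrees_W_pos AE_children[OF AE_ge_\<mu>, of "[]"]
    proof eventually_elim
      case (elim \<nu>)
      show ?case
      proof clarify
        assume *: "\<nu> [] \<noteq> \<mu>" "W \<nu> < x"
        then have "(\<Sum>i<\<nu> []. W (subtree i \<nu>)) < a * x"
          using elim(1) a_gt_1 by (simp add: field_simps)
        \<comment> \<open>N \<ge> \<mu> and N \<noteq> \<mu> give at least one child more, whose
          subtree has index \<mu>.\<close>
        moreover have "(\<Sum>i<Suc \<mu>. W (subtree i \<nu>)) \<le> (\<Sum>i<\<nu> []. W (subtree i \<nu>))"
          using elim(2,3) *(1) by (intro sum_mono2) (auto intro: less_imp_le)
        moreover have "0 \<le> ?S \<nu>"
          using elim(2) by (intro sum_nonneg) (auto intro: less_imp_le)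
        moreover have "0 < W (subtree \<mu> \<nu>)"
          using elim(2) by blast
        ultimately show "?S \<nu> < a * x \<and> W (subtree \<mu> \<nu>) < a * x"
          by simp
      qed
    qed
  qed (rule sets_P_Collect, measurable)
  also have "\<dots> = P.prob {\<nu>. ?S \<nu> < a * x} * P.prob {\<nu>. W \<nu> < a * x}"
    by (rule prob_subtree) (auto intro!: sum.cong arg_cong2[where f = "(<)"])
  also have "P.prob {\<nu>. ?S \<nu> < a * x} = P.prob {\<nu>. \<nu> [] = \<mu> \<and> W \<nu> < x} / prob {\<mu>}"
    using prob_root_sum_less[of "\<lambda>_. True" x] prob_\<mu> by simp
  also have "P.prob {\<nu>. \<nu> [] = \<mu> \<and> W \<nu> < x} \<le> P.prob {\<nu>. W \<nu> < x}"
    by (intro P.finite_measure_mono) (auto intro!: sets_P_Collect)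
  finally show ?thesis
    using prob_\<mu> by (simp add: divide_right_mono mult_right_mono mult.commute)
qed

text \<open>Freezing everything outside subtree \<open>i\<close> turns the condition into W < y - r
  for that subtree alone. As r \<ge> 0 this threshold is at most y, so \<open>bound\<close> applies
  pointwise and is then integrated. It may be negative, hence \<open>bound\<close> is needed for all
  x \<le> y.\<close>

lemma prob_sum_subtree_le:
  assumes [measurable]: "Measurable.pred P A" "r \<in> borel_measurable P"
    and r: "\<And>\<nu> \<xi>. r (override_on \<nu> \<xi> (range (Cons i))) = r \<nu>" "AE \<nu> in P. 0 \<le> r \<nu>"
    and bound: "\<And>x. x \<le> y \<Longrightarrow> P.prob {\<nu>. A \<nu> \<and> W \<nu> < x} \<le> d * P.prob {\<nu>. W \<nu> < x}" and "0 \<le> d"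
  shows "P.prob {\<nu>. A (subtree i \<nu>) \<and> W (subtree i \<nu>) + r \<nu> < y} \<le> d * P.prob {\<nu>. W (subtree i \<nu>) + r \<nu> < y}"
proof -
  have prob: "ennreal (P.prob {\<nu>. B (subtree i \<nu>) \<and> W (subtree i \<nu>) + r \<nu> < y}) =
      (\<integral>\<^sup>+\<nu>. ennreal (P.prob {\<xi>. B \<xi> \<and> W \<xi> < y - r \<nu>}) \<partial>P)" if [measurable]: "Measurable.pred P B" for B
  proof -
    let ?h = "indicator {\<nu>. B (subtree i \<nu>) \<and> W (subtree i \<nu>) + r \<nu> < y} :: _ \<Rightarrow> ennreal"
    have [measurable]: "{\<nu>. B (subtree i \<nu>) \<and> W (subtree i \<nu>) + r \<nu> < y} \<in> sets P"
      by (rule sets_P_Collect) measurable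
    have meas: "{\<xi>. B \<xi> \<and> W \<xi> < z} \<in> sets P" for z
      by (rule sets_P_Collect) measurable
    have "ennreal (P.prob {\<nu>. B (subtree i \<nu>) \<and> W (subtree i \<nu>) + r \<nu> < y}) = (\<integral>\<^sup>+\<nu>. ?h \<nu> \<partial>P)"
      by (simp add: P.emeasure_eq_measure)
    also have "\<dots> = (\<integral>\<^sup>+\<nu>. \<integral>\<^sup>+\<xi>. ?h (override_on \<nu> \<xi> (range (Cons i))) \<partial>P \<partial>P)"
    proof -
      \<comment> \<open>Resampling the complement places subtree \<open>i\<close> in the inner
        integral, where \<open>r\<close> is constant.\<close>
      have "override_on \<xi> \<nu> (- range (Cons i)) = override_on \<nu> \<xi> (range (Cons i))" for \<nu> \<xi> :: "nat list \<Rightarrow> nat"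
        by (auto simp: override_on_def)
      then show ?thesis
        by (subst nn_integral_resample[OF prob_space_axioms, where B = "- range (Cons i)"]) simp_all
    qed
    moreover have "(\<integral>\<^sup>+\<xi>. ?h (override_on \<nu> \<xi> (range (Cons i))) \<partial>P) = P.prob {\<xi>. B \<xi> \<and> W \<xi> < y - r \<nu>}" for \<nu>
    proof -
      have "(\<integral>\<^sup>+\<xi>. ?h (override_on \<nu> \<xi> (range (Cons i))) \<partial>P) =
          (\<integral>\<^sup>+\<xi>. indicator {\<xi>. B \<xi> \<and> W \<xi> < y - r \<nu>} (subtree i \<xi>) \<partial>P)"
        by (intro nn_integral_cong) (auto simp: indicator_def r(1))
      then show ?thesis
        using meas by (subst (asm) nn_integral_subtree) (auto simp: P.emeasure_eq_measure)
    qed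
    ultimately show ?thesis
      by simp
  qed
  have m: "(\<lambda>\<nu>. ennreal (P.prob {\<xi>. W \<xi> < y - r \<nu>})) \<in> borel_measurable P"
  proof -
    have "mono (\<lambda>z. P.prob {\<xi>. W \<xi> < z})"
      by (auto simp: mono_def intro!: P.finite_measure_mono sets_P_Collect)
    then have "(\<lambda>z. P.prob {\<xi>. W \<xi> < z}) \<in> borel_measurable borel"
      by (rule borel_measurable_mono)
    then show ?thesis
      by (intro measurable_compose[OF _ measurable_ennreal]) (rule measurable_compose[where N = borel and g = "\<lambda>z. P.prob {\<xi>. W \<xi> < z}"], auto)
  qed
  have "ennreal (P.prob {\<nu>. A (subtree i \<nu>) \<and> W (subtree i \<nu>) + r \<nu> < y}) \<le>
      (\<integral>\<^sup>+\<nu>. ennreal d * ennreal (P.prob {\<xi>. W \<xi> < y - r \<nu>}) \<partial>P)"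
    unfolding prob[OF assms(1)] using r(2)
    by (intro nn_integral_mono_AE, eventually_elim)
      (use bound \<open>0 \<le> d\<close> in \<open>auto simp flip: ennreal_mult' intro!: ennreal_leI\<close>)
  also have "\<dots> = ennreal (d * P.prob {\<nu>. W (subtree i \<nu>) + r \<nu> < y})"
    using prob[of "\<lambda>_. True"] \<open>0 \<le> d\<close> by (simp add: nn_integral_cmult m ennreal_mult')
  finally show ?thesis
    using \<open>0 \<le> d\<close> by simp
qed

section \<open>Recursion on the depth of agreement with the regular tree\<close>

definition irregular :: "nat \<Rightarrow> rooted_tree \<Rightarrow> bool" where
  "irregular k t \<longleftrightarrow> trunc k t \<noteq> trunc k (regular_tree \<mu>)"

lemma measurable_irregular [measurable]: "Measurable.pred borel (irregular k)"
  unfolding irregular_def[abs_def] by measurable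

text \<open>The root condition is repeated in the second alternative because
  \<open>prob_root_sum_less\<close> requires it.\<close>

lemma irregular_Suc:
  "irregular (Suc k) (tree_of_children \<nu>) \<longleftrightarrow>
    \<nu> [] \<noteq> \<mu> \<or> (\<exists>i<\<mu>. \<nu> [] = \<mu> \<and> irregular k (tree_of_children (subtree i \<nu>)))"
  unfolding irregular_def trunc_Suc_eq_regular_iff by auto

lemma prob_W_less_nonpos: "x \<le> 0 \<Longrightarrow> P.prob {\<nu>. W \<nu> < x} = 0"
  using AE_W_pos by (subst P.prob_eq_0) (auto intro!: sets_P_Collect elim: eventually_mono)

text \<open>The uniformity over all x \<le> y is exactly the hypothesis that
  \<open>prob_sum_subtree_le\<close> consumes at the next depth. Depth 0 is trivial, as every tree
  has a root.\<close>

lemma ex_prob_irregular_le: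
  assumes "0 < d"
  shows "\<exists>y>0. \<forall>x\<le>y. P.prob {\<nu>. irregular k (tree_of_children \<nu>) \<and> W \<nu> < x} \<le> d * P.prob {\<nu>. W \<nu> < x}"
  using assms
proof (induction k arbitrary: d)
  case 0
  then show ?case
    by (auto simp: irregular_def intro!: exI[of _ 1])
next
  case (Suc k)
  let ?bad = "\<lambda>k \<nu>. irregular k (tree_of_children \<nu>)" and ?F = "\<lambda>x. P.prob {\<nu>. W \<nu> < x}"
  \<comment> \<open>Half of \<open>d\<close> pays for a wrong number of children at the root, the
    other half is shared by the \<mu> subtrees.\<close>
  let ?d = "d / 2 / \<mu>"
  have d: "0 < ?d" "real \<mu> * ?d = d / 2"
    using Suc.prems \<mu>_ge_1 by auto
  obtain y0 where y0: "0 < y0" "\<And>x. x \<le> y0 \<Longrightarrow> P.prob {\<nu>. ?bad k \<nu> \<and> W \<nu> < x} \<le> ?d * ?F x"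
    using Suc.IH[OF d(1)] by blast
  have "\<forall>\<^sub>F x in at_right 0. ?F x < d / 2 * prob {\<mu>}"
    using prob_W_less_tendsto_0 Suc.prems prob_\<mu> by (intro order_tendstoD) auto
  then obtain y1 where y1: "0 < y1" "\<And>x. 0 < x \<Longrightarrow> x < y1 \<Longrightarrow> ?F x < d / 2 * prob {\<mu>}"
    by (auto simp: eventually_at_right_field)
  \<comment> \<open>The division by \<open>a\<close> accounts for the threshold a x in the subtrees;
    halving \<open>y1\<close> keeps the second inequality strict.\<close>
  define y where "y = min y0 (y1 / 2) / a"
  have y: "0 < y" "\<And>x. x \<le> y \<Longrightarrow> a * x \<le> y0 \<and> a * x < y1"
    using y0(1) y1(1) a_gt_1 by (auto simp: y_def field_simps min_def split: if_splits)
  have "P.prob {\<nu>. ?bad (Suc k) \<nu> \<and> W \<nu> < x} \<le> d * ?F x" if "x \<le> y" for x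
  proof (cases "0 < x")
    case False
    then have "P.prob {\<nu>. ?bad (Suc k) \<nu> \<and> W \<nu> < x} \<le> ?F x" "?F x = 0"
      by (auto intro!: P.finite_measure_mono sets_P_Collect prob_W_less_nonpos)
    then show ?thesis by simp
  next
    case True
    let ?S = "\<lambda>\<nu>. \<Sum>i<\<mu>. W (subtree i \<nu>)"
    let ?B = "\<lambda>i. {\<nu>. ?bad k (subtree i \<nu>) \<and> \<nu> [] = \<mu> \<and> W \<nu> < x}"
    have B: "?B i \<in> sets P" for i
      by (rule sets_P_Collect) measurable
    have "{\<nu>. \<nu> [] \<noteq> \<mu> \<and> W \<nu> < x} \<in> sets P"
      by (rule sets_P_Collect) measurable
    note sets = B this
    have root: "P.prob {\<nu>. \<nu> [] \<noteq> \<mu> \<and> W \<nu> < x} \<le> d / 2 * ?F x"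
    proof (rule order_trans[OF prob_root_ne_\<mu>_le])
      have "?F (a * x) \<le> d / 2 * prob {\<mu>}"
        using True y(2)[OF that] y1(2)[of "a * x"] a_gt_1 by (auto intro: less_imp_le)
      then have "?F (a * x) / prob {\<mu>} \<le> d / 2"
        using prob_\<mu> by (simp add: field_simps)
      then show "?F (a * x) / prob {\<mu>} * ?F x \<le> d / 2 * ?F x"
        by (intro mult_right_mono) auto
    qed
    have child: "P.prob (?B i) \<le> ?d * ?F x" if i: "i < \<mu>" for i
    proof -
      let ?r = "\<lambda>\<nu>. \<Sum>j\<in>{..<\<mu>} - {i}. W (subtree j \<nu>)"
      have S: "?S \<nu> = W (subtree i \<nu>) + ?r \<nu>" for \<nu>
        using i by (intro sum.remove) auto
      have "P.prob (?B i) = P.prob {\<nu>. ?bad k (subtree i \<nu>) \<and> ?S \<nu> < a * x} * prob {\<mu>}"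
        by (rule prob_root_sum_less) auto
      also have "P.prob {\<nu>. ?bad k (subtree i \<nu>) \<and> ?S \<nu> < a * x} \<le> ?d * P.prob {\<nu>. ?S \<nu> < a * x}"
        unfolding S
      proof (rule prob_sum_subtree_le)
        show "AE \<nu> in P. 0 \<le> ?r \<nu>"
          using AE_subtrees_W_pos by eventually_elim (intro sum_nonneg less_imp_le[of 0 "W _"], blast)
        show "?r (override_on \<nu> \<xi> (range (Cons i))) = ?r \<nu>" for \<nu> \<xi>
          by (intro sum.cong) auto
      qed (use d y0(2) y(2)[OF \<open>x \<le> y\<close>] in auto)
      \<comment> \<open>Going back from the sum to W cancels the factor P(N = \<mu>), so no constant
        accumulates with the depth.\<close>
      also have "P.prob {\<nu>. ?S \<nu> < a * x} = P.prob {\<nu>. \<nu> [] = \<mu> \<and> W \<nu> < x} / prob {\<mu>}"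
        using prob_root_sum_less[of "\<lambda>_. True" x] prob_\<mu> by simp
      finally have "P.prob (?B i) \<le> ?d * P.prob {\<nu>. \<nu> [] = \<mu> \<and> W \<nu> < x}"
        using prob_\<mu> by (simp add: mult_right_mono)
      also have "\<dots> \<le> ?d * ?F x"
        using d(1) by (intro mult_left_mono P.finite_measure_mono) (auto intro!: sets_P_Collect)
      finally show ?thesis .
    qed
    have "{\<nu>. ?bad (Suc k) \<nu> \<and> W \<nu> < x} \<subseteq> {\<nu>. \<nu> [] \<noteq> \<mu> \<and> W \<nu> < x} \<union> (\<Union>i<\<mu>. ?B i)"
      by (auto simp: irregular_Suc)
    then have "P.prob {\<nu>. ?bad (Suc k) \<nu> \<and> W \<nu> < x} \<le> P.prob ({\<nu>. \<nu> [] \<noteq> \<mu> \<and> W \<nu> < x} \<union> (\<Union>i<\<mu>. ?B i))"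
      using sets by (intro P.finite_measure_mono sets.Un sets.finite_UN) auto
    also have "\<dots> \<le> P.prob {\<nu>. \<nu> [] \<noteq> \<mu> \<and> W \<nu> < x} + P.prob (\<Union>i<\<mu>. ?B i)"
      using sets by (intro measure_Un_le sets.finite_UN) auto
    also have "P.prob (\<Union>i<\<mu>. ?B i) \<le> (\<Sum>i<\<mu>. P.prob (?B i))"
      using sets by (intro P.finite_measure_subadditive_finite) auto
    also have "\<dots> \<le> (\<Sum>i<\<mu>. ?d * ?F x)"
      using child by (intro sum_mono) auto
    also have "\<dots> = d / 2 * ?F x"
      using \<mu>_ge_1 by simp
    finally show ?thesis
      using root by simp
  qed
  with y(1) show ?case by blast
qed

lemma prob_irregular_tendsto_0:
  "((\<lambda>x. P.prob {\<nu>. irregular k (tree_of_children \<nu>) \<and> W \<nu> < x} / P.prob {\<nu>. W \<nu> < x}) \<longlongrightarrow> 0) (at_right 0)"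
proof (rule tendstoI)
  fix e :: real assume "0 < e"
  then obtain y where y: "0 < y" "\<And>x. x \<le> y \<Longrightarrow>
      P.prob {\<nu>. irregular k (tree_of_children \<nu>) \<and> W \<nu> < x} \<le> e / 2 * P.prob {\<nu>. W \<nu> < x}"
    using ex_prob_irregular_le[of "e / 2" k] by auto
  have "P.prob {\<nu>. irregular k (tree_of_children \<nu>) \<and> W \<nu> < x} / P.prob {\<nu>. W \<nu> < x} < e" if "0 < x" "x < y" for x
  proof -
    have "P.prob {\<nu>. irregular k (tree_of_children \<nu>) \<and> W \<nu> < x} / P.prob {\<nu>. W \<nu> < x} \<le> e / 2"
      using y(2)[of x] that prob_W_less_pos[of x] by (simp add: pos_divide_le_eq)
    also have "\<dots> < e"
      using \<open>0 < e\<close> by simp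
    finally show ?thesis .
  qed
  then show "\<forall>\<^sub>F x in at_right 0.
      dist (P.prob {\<nu>. irregular k (tree_of_children \<nu>) \<and> W \<nu> < x} / P.prob {\<nu>. W \<nu> < x}) 0 < e"
    using y(1) by (auto simp: eventually_at_right_field intro!: exI[of _ y])
qed

end

section \<open>Transfer to arbitrary probability spaces\<close>

lemma galton_watson_distr:
  assumes "prob_space Q" and [measurable]: "N \<in> Q \<rightarrow>\<^sub>M count_space UNIV"
    and N_ge: "AE x in Q. N x \<ge> 1" and nondeg: "\<not> (\<exists>c. AE x in Q. N x = c)"
    and NlogN: "integrable Q (\<lambda>x. real (N x) * ln (real (N x)))"
  shows "galton_watson (distr Q (count_space UNIV) N) (\<integral>x. real (N x) \<partial>Q) (LEAST n. \<P>(x in Q. N x = n) > 0)"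
    (is "galton_watson ?L ?a ?\<mu>")
proof -
  interpret Q: prob_space Q by fact
  \<comment> \<open>Without an atom, \<open>N\<close> would almost surely avoid each of the
    countably many values.\<close>
  have ex: "\<exists>n. \<P>(x in Q. N x = n) > 0"
  proof (rule ccontr)
    assume "\<not> ?thesis"
    then have "\<P>(x in Q. N x = n) = 0" for n
      by (simp add: zero_less_measure_iff)
    then have "AE x in Q. N x \<noteq> n" for n
      by (subst (asm) Q.prob_Collect_eq_0) auto
    then have "AE x in Q. \<forall>n. N x \<noteq> n"
      by (subst AE_all_countable) blast
    then show False
      by simp
  qed
  have \<mu>: "\<P>(x in Q. N x = ?\<mu>) > 0"
    using ex by (rule LeastI_ex)
  have "AE x in Q. n < ?\<mu> \<longrightarrow> N x \<noteq> n" for n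
  proof (cases "n < ?\<mu>")
    case True
    then have "\<P>(x in Q. N x = n) = 0"
      using not_less_Least zero_less_measure_iff by blast
    then show ?thesis
      by (subst (asm) Q.prob_Collect_eq_0) auto
  qed simp
  then have "AE x in Q. \<forall>n. n < ?\<mu> \<longrightarrow> N x \<noteq> n"
    by (simp add: AE_all_countable)
  then have N_ge_\<mu>: "AE x in Q. ?\<mu> \<le> N x"
    by eventually_elim (auto simp: not_less[symmetric])
  have intN: "integrable Q (\<lambda>x. real (N x))"
  proof (rule Bochner_Integration.integrable_bound)
    show "integrable Q (\<lambda>x. exp 1 + real (N x) * ln (real (N x)))"
      using NlogN by simp
    \<comment> \<open>Either n \<le> e or ln n \<ge> 1; so the N log N moment yields a finite
      mean.\<close>
    have le: "real n \<le> exp 1 + real n * ln (real n)" if "1 \<le> n" for n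
    proof (cases "exp 1 \<le> real n")
      case True
      then have "1 \<le> ln (real n)"
        using that by (subst ln_ge_iff) auto
      then have "real n * 1 \<le> real n * ln (real n)"
        by (intro mult_left_mono) auto
      then show ?thesis
        by (simp add: add_increasing)
    next
      case False
      then show ?thesis
        using that by (simp add: add_increasing2)
    qed
    show "AE x in Q. norm (real (N x)) \<le> norm (exp 1 + real (N x) * ln (real (N x)))"
      using N_ge by eventually_elim (use le in \<open>auto intro!: order_trans[OF _ abs_ge_self]\<close>)
  qed simp
  \<comment> \<open>A nonnegative variable N - \<mu> with mean at most 0 vanishes almost surely,
    which nondegeneracy excludes.\<close>
  have "real ?\<mu> < ?a"
  proof (rule ccontr)
    assume "\<not> ?thesis"
    moreover have nonneg: "AE x in Q. 0 \<le> real (N x) - real ?\<mu>"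
      using N_ge_\<mu> by eventually_elim auto
    then have "0 \<le> (\<integral>x. real (N x) - real ?\<mu> \<partial>Q)"
      by (rule integral_nonneg_AE)
    ultimately have "(\<integral>x. real (N x) - real ?\<mu> \<partial>Q) = 0"
      using intN by (simp add: Q.prob_space)
    then have "AE x in Q. real (N x) - real ?\<mu> = 0"
      using integral_nonneg_eq_0_iff_AE[OF _ nonneg] intN by simp
    then have "AE x in Q. N x = ?\<mu>"
      by eventually_elim simp
    then show False
      using nondeg by blast
  qed
  moreover have "1 \<le> ?\<mu>"
  proof (rule ccontr)
    assume "\<not> ?thesis"
    then have "AE x in Q. N x \<noteq> ?\<mu>"
      using N_ge by (auto elim: eventually_mono)
    then show False
      using \<mu> by (subst (asm) Q.prob_Collect_eq_0[symmetric]) auto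
  qed
  moreover have "measure ?L {?\<mu>} = \<P>(x in Q. N x = ?\<mu>)"
    by (subst measure_distr) (auto intro!: arg_cong[where f = Q.prob])
  moreover have "AE n in ?L. ?\<mu> \<le> n"
    using N_ge_\<mu> by (subst AE_distr_iff) auto
  ultimately show ?thesis
    using intN NlogN \<mu>
    by (intro galton_watson.intro offspring.intro galton_watson_axioms.intro offspring_axioms.intro Q.prob_space_distr)
      (simp_all add: integrable_distr_eq integral_distr)
qed

lemma galton_watson_tree_prob:
  assumes "galton_watson_tree Q N M T" and "N \<in> Q \<rightarrow>\<^sub>M count_space UNIV" and "Measurable.pred borel R"
  shows "\<P>(\<omega> in M. R (T \<omega>)) =
    measure (\<Pi>\<^sub>M u\<in>UNIV. distr Q (count_space UNIV) N) {\<nu>. R (tree_of_children \<nu>)}"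
proof -
  let ?P = "\<Pi>\<^sub>M (u :: nat list)\<in>UNIV. distr Q (count_space UNIV) N"
  have T: "T \<in> M \<rightarrow>\<^sub>M borel" "distr M borel T = distr ?P borel tree_of_children"
    using assms(1) by (auto simp: galton_watson_tree_def galton_watson_law_def)
  have tree: "tree_of_children \<in> ?P \<rightarrow>\<^sub>M borel"
    by (rule measurable_tree_of_children) simp
  have R: "{t. R t} \<in> sets borel"
    using assms(3) by (simp add: pred_def)
  have "\<P>(\<omega> in M. R (T \<omega>)) = measure (distr M borel T) {t. R t}"
    using R T(1) by (subst measure_distr) (auto intro!: arg_cong[where f = "measure M"])
  also have "\<dots> = measure ?P {\<nu>. R (tree_of_children \<nu>)}"
    unfolding T(2) using R tree
    by (subst measure_distr) (auto simp: space_PiM intro!: arg_cong[where f = "measure ?P"])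
  finally show ?thesis .
qed

text \<open>The limit is deterministic, so agreement up to each depth in conditional probability
  suffices: a continuous function is within e / 2 of its value at \<open>t\<close> on trees agreeing
  with \<open>t\<close> deeply enough, and the rest contributes at most 2 B times a small
  probability.\<close>

lemma converges_in_law_point_mass:
  fixes t :: rooted_tree
  assumes M: "prob_space M" and [measurable]: "T \<in> M \<rightarrow>\<^sub>M borel" and [measurable]: "\<And>i. Measurable.pred M (E i)"
    and pos: "\<forall>\<^sub>F i in F. 0 < \<P>(\<omega> in M. E i \<omega>)"
    and lim: "\<And>n. ((\<lambda>i. \<P>(\<omega> in M. trunc n (T \<omega>) \<noteq> trunc n t \<bar> E i \<omega>)) \<longlongrightarrow> 0) F"
  shows "converges_in_law (\<lambda>i. conditional_law M T (E i)) (return borel t) F"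
  unfolding converges_in_law_def
proof (intro allI impI)
  interpret M: prob_space M by fact
  fix f :: "rooted_tree \<Rightarrow> real"
  assume cont: "continuous_on UNIV f" and bdd: "bounded (range f)"
  have [measurable]: "f \<in> borel_measurable borel"
    using cont by (rule borel_measurable_continuous_onI)
  obtain B where B: "\<And>s. \<bar>f s\<bar> \<le> B"
    using bdd by (auto simp: bounded_iff)
  show "((\<lambda>i. integral\<^sup>L (conditional_law M T (E i)) f) \<longlongrightarrow> integral\<^sup>L (return borel t) f) F"
  proof (rule tendstoI)
    fix e :: real assume e: "0 < e"
    then obtain n where n: "\<And>s. trunc n s = trunc n t \<Longrightarrow> \<bar>f s - f t\<bar> < e / 2"
      using trunc_eq_if_close[OF cont, of "e / 2" t] by auto
    have B0: "0 \<le> B"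
      using B[of t] by simp
    \<comment> \<open>The summand 1 in the denominator avoids dividing by zero when
      \<open>B = 0\<close>.\<close>
    have "\<forall>\<^sub>F i in F. \<P>(\<omega> in M. trunc n (T \<omega>) \<noteq> trunc n t \<bar> E i \<omega>) < e / 2 / (2 * B + 1)"
      using e B0 by (intro order_tendstoD[OF lim]) auto
    with pos show "\<forall>\<^sub>F i in F. dist (integral\<^sup>L (conditional_law M T (E i)) f) (integral\<^sup>L (return borel t) f) < e"
    proof eventually_elim
      case (elim i)
      let ?A = "{\<omega> \<in> space M. E i \<omega>}" and ?C = "{\<omega> \<in> space M. trunc n (T \<omega>) \<noteq> trunc n t}"
      let ?U = "uniform_measure M ?A"
      have A: "emeasure M ?A \<noteq> 0" "emeasure M ?A \<noteq> \<infinity>"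
        using elim(1) by (auto simp: M.emeasure_eq_measure)
      interpret U: prob_space ?U
        using A by (rule prob_space_uniform_measure)
      have [simp]: "U.prob (space M) = 1"
        using U.prob_space by simp
      have C [measurable]: "?C \<in> sets M"
        by measurable
      have "U.prob ?C = \<P>(\<omega> in M. trunc n (T \<omega>) \<noteq> trunc n t \<bar> E i \<omega>)"
        using A by (subst measure_uniform_measure)
          (auto simp: cond_prob_def intro!: arg_cong2[where f = "(/)"] arg_cong[where f = "measure M"])
      then have "(2 * B + 1) * U.prob ?C < e / 2"
        using elim(2) B0 by (simp add: field_simps)
      then have "2 * B * U.prob ?C < e / 2"
        using measure_nonneg[of ?U ?C] unfolding distrib_right by linarith
      moreover have T: "T \<in> ?U \<rightarrow>\<^sub>M borel"
        by simp
      have int: "integrable ?U (\<lambda>\<omega>. f (T \<omega>))"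
        by (rule U.integrable_const_bound[where B = B]) (auto simp: B)
      have intC: "integrable ?U (indicator ?C :: _ \<Rightarrow> real)"
        by (rule U.integrable_const_bound[where B = 1]) auto
      have "integral\<^sup>L (conditional_law M T (E i)) f = (\<integral>\<omega>. f (T \<omega>) \<partial>?U)"
        unfolding conditional_law_def by (rule integral_distr) (auto simp: T)
      then have dist: "dist (integral\<^sup>L (conditional_law M T (E i)) f) (integral\<^sup>L (return borel t) f) =
          \<bar>\<integral>\<omega>. f (T \<omega>) - f t \<partial>?U\<bar>"
        using int by (simp add: integral_return dist_real_def U.prob_space)
      have bound: "\<bar>\<integral>\<omega>. f (T \<omega>) - f t \<partial>?U\<bar> \<le> (\<integral>\<omega>. e / 2 + 2 * B * indicator ?C \<omega> \<partial>?U)"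
      proof (rule order_trans[OF integral_abs_bound integral_mono_AE])
        show "AE \<omega> in ?U. \<bar>f (T \<omega>) - f t\<bar> \<le> e / 2 + 2 * B * indicator ?C \<omega>"
        proof (rule AE_I2)
          fix \<omega> assume "\<omega> \<in> space ?U"
          then show "\<bar>f (T \<omega>) - f t\<bar> \<le> e / 2 + 2 * B * indicator ?C \<omega>"
            using n[of "T \<omega>"] B[of "T \<omega>"] B[of t] e by (cases "\<omega> \<in> ?C") auto
        qed
      qed (use int intC in auto)
      have val: "(\<integral>\<omega>. e / 2 + 2 * B * indicator ?C \<omega> \<partial>?U) = e / 2 + 2 * B * U.prob ?C"
      proof -
        have "(\<integral>\<omega>. indicator ?C \<omega> \<partial>?U) = U.prob ?C"
          by (subst Bochner_Integration.integral_indicator) (auto intro!: arg_cong[where f = U.prob])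
        then show ?thesis
          using intC by simp
      qed
      show ?case
        using \<open>2 * B * U.prob ?C < e / 2\<close> bound unfolding dist val by linarith
    qed
  qed
qed

theorem theorem1:
  fixes Q :: "'b measure" and N :: "'b \<Rightarrow> nat"
    and M :: "'a measure" and T :: "'a \<Rightarrow> rooted_tree"
    and a :: real and \<mu> :: nat and Z :: "nat \<Rightarrow> 'a \<Rightarrow> nat" and W :: "'a \<Rightarrow> real"
  assumes "prob_space Q" and "N \<in> Q \<rightarrow>\<^sub>M count_space UNIV"
    and "AE x in Q. N x \<ge> 1"
    and "\<not> (\<exists>c. AE x in Q. N x = c)"
    and "integrable Q (\<lambda>x. real (N x) * ln (real (N x)))"
    and "prob_space M" and "galton_watson_tree Q N M T"
    and "\<mu> = (LEAST n. \<P>(x in Q. N x = n) > 0)"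
    and "a = (\<integral>x. real (N x) \<partial>Q)"
    and "Z = (\<lambda>k \<omega>. generation_size (T \<omega>) k)"
    and "W = (\<lambda>\<omega>. lim (\<lambda>n. real (Z n \<omega>) / a ^ n))"
  shows "converges_in_law (\<lambda>\<epsilon>. conditional_law M T (\<lambda>\<omega>. W \<omega> < \<epsilon>))
           (return borel (regular_tree \<mu>)) (at_right 0)
       \<and> (\<forall>k. ((\<lambda>\<epsilon>. \<P>(\<omega> in M. Z k \<omega> = \<mu> ^ k \<bar> W \<omega> < \<epsilon>)) \<longlongrightarrow> 1) (at_right 0))"
proof -
  let ?L = "distr Q (count_space UNIV) N"
  interpret GW: galton_watson ?L a \<mu>
    unfolding assms(8,9) using assms(1-5) by (rule galton_watson_distr)
  interpret M: prob_space M by fact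
  have T [measurable]: "T \<in> M \<rightarrow>\<^sub>M borel"
    using assms(7) by (simp add: galton_watson_tree_def)
  have W: "W = (\<lambda>\<omega>. GW.limit_of (T \<omega>))"
    by (simp add: assms(10,11) GW.limit_of_def)
  note transfer = galton_watson_tree_prob[OF assms(7,2)]
  have pos: "0 < \<P>(\<omega> in M. W \<omega> < \<epsilon>)" if "0 < \<epsilon>" for \<epsilon>
    using GW.prob_W_less_pos[OF that] transfer[of "\<lambda>t. GW.limit_of t < \<epsilon>"] by (simp add: W)
  have irregular: "((\<lambda>\<epsilon>. \<P>(\<omega> in M. GW.irregular k (T \<omega>) \<bar> W \<omega> < \<epsilon>)) \<longlongrightarrow> 0) (at_right 0)" for k
    using GW.prob_irregular_tendsto_0[of k] transfer[of "\<lambda>t. GW.limit_of t < \<epsilon>" for \<epsilon>]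
      transfer[of "\<lambda>t. GW.irregular k t \<and> GW.limit_of t < \<epsilon>" for \<epsilon>]
    by (simp add: cond_prob_def W)
  have "converges_in_law (\<lambda>\<epsilon>. conditional_law M T (\<lambda>\<omega>. W \<omega> < \<epsilon>)) (return borel (regular_tree \<mu>)) (at_right 0)"
  proof (rule converges_in_law_point_mass)
    show "\<forall>\<^sub>F \<epsilon> in at_right 0. 0 < \<P>(\<omega> in M. W \<omega> < \<epsilon>)"
      using pos by (auto simp: eventually_at_right_field intro!: exI[of _ 1])
    show "Measurable.pred M (\<lambda>\<omega>. W \<omega> < \<epsilon>)" for \<epsilon>
      unfolding W by measurable
  qed (use irregular in \<open>auto simp: GW.irregular_def assms(6)\<close>)
  moreover have "((\<lambda>\<epsilon>. \<P>(\<omega> in M. Z k \<omega> = \<mu> ^ k \<bar> W \<omega> < \<epsilon>)) \<longlongrightarrow> 1) (at_right 0)" for k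
  proof (rule tendsto_sandwich)
    let ?W = "\<lambda>\<epsilon>. \<P>(\<omega> in M. W \<omega> < \<epsilon>)"
    \<comment> \<open>Agreement with the regular tree up to generation \<open>k\<close> fixes the
      size of that generation, so \<open>Z k \<omega> = \<mu> ^ k\<close> can fail only on irregular
      trees.\<close>
    have "1 - \<P>(\<omega> in M. GW.irregular k (T \<omega>) \<bar> W \<omega> < \<epsilon>) \<le> \<P>(\<omega> in M. Z k \<omega> = \<mu> ^ k \<bar> W \<omega> < \<epsilon>)
      \<and> \<P>(\<omega> in M. Z k \<omega> = \<mu> ^ k \<bar> W \<omega> < \<epsilon>) \<le> 1" if "0 < \<epsilon>" for \<epsilon>
    proof -
      let ?Z = "\<P>(\<omega> in M. Z k \<omega> = \<mu> ^ k \<and> W \<omega> < \<epsilon>)" and ?I = "\<P>(\<omega> in M. GW.irregular k (T \<omega>) \<and> W \<omega> < \<epsilon>)"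
      have sets [measurable]: "Measurable.pred M (\<lambda>\<omega>. W \<omega> < \<epsilon>)" "Measurable.pred M (\<lambda>\<omega>. Z k \<omega> = \<mu> ^ k)"
        unfolding W assms(10) by measurable
      have "{\<omega> \<in> space M. W \<omega> < \<epsilon>} \<subseteq> {\<omega> \<in> space M. Z k \<omega> = \<mu> ^ k \<and> W \<omega> < \<epsilon>}
          \<union> {\<omega> \<in> space M. GW.irregular k (T \<omega>) \<and> W \<omega> < \<epsilon>}"
        using generation_size_trunc generation_size_regular_tree[of \<mu> k]
        by (auto simp: GW.irregular_def assms(10))
      then have "?W \<epsilon> \<le> ?Z + ?I"
        by (intro order_trans[OF M.finite_measure_mono measure_Un_le]) auto
      moreover have "?Z \<le> ?W \<epsilon>"
        by (intro M.finite_measure_mono) auto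
      ultimately show ?thesis
        using pos[OF that] by (simp add: cond_prob_def diff_le_eq add_divide_distrib[symmetric] add.commute)
    qed
    then show "\<forall>\<^sub>F \<epsilon> in at_right 0.
        1 - \<P>(\<omega> in M. GW.irregular k (T \<omega>) \<bar> W \<omega> < \<epsilon>) \<le> \<P>(\<omega> in M. Z k \<omega> = \<mu> ^ k \<bar> W \<omega> < \<epsilon>)"
      "\<forall>\<^sub>F \<epsilon> in at_right 0. \<P>(\<omega> in M. Z k \<omega> = \<mu> ^ k \<bar> W \<omega> < \<epsilon>) \<le> 1"
      by (auto simp: eventually_at_right_field intro!: exI[of _ 1])
    show "((\<lambda>\<epsilon>. 1 - \<P>(\<omega> in M. GW.irregular k (T \<omega>) \<bar> W \<omega> < \<epsilon>)) \<longlongrightarrow> 1) (at_right 0)"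
      using tendsto_diff[OF tendsto_const irregular[of k], of 1] by simp
  qed simp
  ultimately show ?thesis
    by blast
qed

end
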